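(* Consider the affine delegated equilibrium $a_{kt}=\alpha_t+\gamma_{kt}m_{kt}$ with aggregate action $A_t=\sum_kx_ka_{kt}$, and set $\mathcal S_t:=\sum_kx_k\gamma_{kt}$, $Q_t:=\sum_kx_k^2\gamma_{kt}^2$. Assume: (W1) the regional clearing price is $P_t=\omega_0+\omega_1A_t$ with $\omega_1>0$; (W2) consumer load is $D_t=D_0+\upsilon\,\theta_t$ with $\upsilon\ge0$ and $D_0$ large enough that $D_t>0$ on the relevant range (only the moments $\mathbb E[D_t]=D_0$ and $\mathrm{Cov}(D_t,\theta_t)=\upsilon/\tau_\theta$ enter below); (W3) period consumer loss is $\mathcal L_t=P_tD_t+\tfrac{\kappa}{2}\bigl(P_t-\mathbb E[P_t]\bigr)^2$ with $\kappa\ge0$. Then expected consumer loss decomposes as $$\mathbb E[\mathcal L_t]=L_0+\underbrace{\omega_1\upsilon\,\mathcal V_t\mathcal S_t}_{\mathrm{(I)}}+\underbrace{\tfrac{\kappa}{2}\,\omega_1^2\,\mathcal V_t\bigl(\rho_t\mathcal S_t^2+(1-\rho_t)Q_t\bigr)}_{\mathrm{(II)}},$$ where $L_0:=\omega_0D_0+\omega_1D_0\alpha_t$ is independent of the share vector $x$. Terms (I) and (II) equal $\mathrm{Cov}(P_t,D_t)$ and $\tfrac{\kappa}{2}\mathrm{Var}(P_t)$, respectively. The mean price $\mathbb E[P_t]=\omega_0+\omega_1\alpha_t$ is invariant to $x$, and along any majorization-increasing (concentration-increasing) change in $x$ both (I) and (II) weakly increase, so $\mathbb E[\mathcal L_t]$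 weakly increases; the increase is strict along the dominant-provider family $$x(x_D)=\Bigl(x_D,\tfrac{1-x_D}{K-1},\dots,\tfrac{1-x_D}{K-1}\Bigr),\qquad x_D\in[1/K,1],$$ for interior $x_D\in(1/K,1)$.
   Context: Signals. The scarcity state $\theta_t$ is the time-$t$ value of a stationary mean-zero Gaussian process with $\mathrm{Var}(\theta_t)=\tau_\theta^{-1}$. All providers $k=1,\dots,K$ observe the public signal $g_t=\theta_t+\eta_{0t}$, and provider $k$ additionally observes the private signal $y_{kt}=\theta_t+\eta_{kt}$, where $\eta_{0t}\sim\mathcal N(0,\tau_g^{-1})$, $\eta_{kt}\sim\mathcal N(0,\tau_y^{-1})$, and all noise terms are mutually independent and independent of the scarcity process. Provider $k$'s posterior mean is $m_{kt}:=\mathbb E[\theta_t\mid g_t,y_{kt}]$. With $T:=\tau_\theta+\tau_g+\tau_y$, put $\mathcal V_t:=\mathrm{Var}(m_{kt})=\frac{\tau_g+\tau_y}{\tau_\theta T}$ and, for $j\ne k$, $\rho_t:=\mathrm{Cov}(m_{kt},m_{jt})/\mathrm{Var}(m_{kt})=1-\frac{\tau_\theta\tau_y}{(\tau_g+\tau_y)T}\in(0,1)$. The precisions $(\tau_g,\tau_y)$ are held fixed throughout, so $\mathcal V_t$ and $\rho_t$ are fixed and only the provider-share vector $x$ varies. Game. Provider $k$ controls share $x_k\ge0$, with $\sum_kx_k=1$. All batteries (clients) using provider $k$ receive $m_{kt}$ and choose the same scalar action $a_{kt}$; $A_t:=\sum_{k=1}^Kx_ka_{kt}$. The payoff of a provider-$k$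 client from action $a$ is $$\Pi_{kt}(a\mid m_{kt})=(a-c_t)\bigl(\psi_t+\xi_tm_{kt}-\beta_ta+d_t\,\mathbb E[A_t\mid m_{kt}]\bigr),$$ with $\beta_t>0$, $0<d_t<\beta_t$, $\xi_t>0$; in the client's first-order condition $\mathbb E[A_t\mid m_{kt}]$ is taken as given. An affine delegated equilibrium is a vector $(\alpha_{kt},\gamma_{kt})_{k=1}^K$ such that every client of provider $k$ chooses $a_{kt}=\alpha_{kt}+\gamma_{kt}m_{kt}$ and this action is optimal for the payoff above. It exists and is unique, with $\alpha_{kt}=\alpha_t=\frac{\psi_t+\beta_tc_t}{2\beta_t-d_t}$ for all $k$ and $$\gamma_{kt}=\frac{\xi_t}{1-d_t\rho_t\Lambda_t(x)}\,\frac1{2\beta_t-d_t(1-\rho_t)x_k},\qquad \Lambda_t(x)=\sum_{k=1}^K\frac{x_k}{2\beta_t-d_t(1-\rho_t)x_k}.$$ A majorization-increasing change in $x$ replaces $x$ by a share vector $x'$ that majorizes it: for each $n\le K$, the sum of the $n$ largest entries of $x'$ is at least that of $x$, with equality for $n=K$.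
   Formalization: Strictness along the dominant-provider family is stated for (I) if υ>0, for (II) if κ>0, and for expected loss if υ>0 or κ>0; as written it fails, since for υ=κ=0 the expected loss equals the constant L_0. *)

theory Defs
  imports "HOL-Probability.Probability"
begin

definition covariance :: "'a measure \<Rightarrow> ('a \<Rightarrow> real) \<Rightarrow> ('a \<Rightarrow> real) \<Rightarrow> real" where
  "covariance M X Y =
     prob_space.expectation M
       (\<lambda>\<omega>. (X \<omega> - prob_space.expectation M X) * (Y \<omega> - prob_space.expectation M Y))"

text \<open>A constant counts as a (degenerate) Gaussian variable, as is needed for linear combinations
  of the values of a process.\<close>

definition gaussian_variable :: "'a measure \<Rightarrow> ('a \<Rightarrow> real) \<Rightarrow> bool" where
  "gaussian_variable M X \<longleftrightarrow>
     X \<in> borel_measurable M \<and>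
     ((\<exists>\<mu> \<sigma>. \<sigma> > 0 \<and> distributed M lborel X (normal_density \<mu> \<sigma>)) \<or>
      (\<exists>\<mu>. AE \<omega> in M. X \<omega> = \<mu>))"

definition gaussian_process :: "'a measure \<Rightarrow> ('t \<Rightarrow> 'a \<Rightarrow> real) \<Rightarrow> bool" where
  "gaussian_process M X \<longleftrightarrow>
     (\<forall>J c. finite J \<longrightarrow> gaussian_variable M (\<lambda>\<omega>. \<Sum>s\<in>J. c s * X s \<omega>))"

definition stationary_process ::
  "'a measure \<Rightarrow> ('t::linordered_ab_semigroup_add \<Rightarrow> 'a \<Rightarrow> real) \<Rightarrow> bool" where
  "stationary_process M X \<longleftrightarrow>
     (\<forall>J h. finite J \<longrightarrow>
        distr M (PiM J (\<lambda>_. borel)) (\<lambda>\<omega>. \<lambda>s\<in>J. X (s + h) \<omega>) =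
        distr M (PiM J (\<lambda>_. borel)) (\<lambda>\<omega>. \<lambda>s\<in>J. X s \<omega>))"

text \<open>The time index is any linearly ordered abelian semigroup, such as the naturals, the integers
  or the reals. Noise \<open>\<eta> 0\<close> belongs to the public signal, noise \<open>\<eta> k\<close> with \<open>1 \<le> k \<le> K\<close> to the
  private signal of provider \<open>k\<close>. The parameters \<open>\<tau>\<^sub>\<theta>\<close>, \<open>\<tau>\<^sub>g\<close>, \<open>\<tau>\<^sub>y\<close> are precisions, whereas the second
  argument of \<^const>\<open>normal_density\<close> is a standard deviation.\<close>

locale scarcity_signals = prob_space M
  for M :: "'a measure" +
  fixes \<theta> :: "'t::linordered_ab_semigroup_add \<Rightarrow> 'a \<Rightarrow> real"
    and \<eta> :: "nat \<Rightarrow> 't \<Rightarrow> 'a \<Rightarrow> real"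
    and K :: nat
    and \<tau>\<^sub>\<theta> \<tau>\<^sub>g \<tau>\<^sub>y :: real
  assumes precisions_pos: "\<tau>\<^sub>\<theta> > 0" "\<tau>\<^sub>g > 0" "\<tau>\<^sub>y > 0"
    and state_gaussian: "gaussian_process M \<theta>"
    and state_stationary: "stationary_process M \<theta>"
    and state_mean: "expectation (\<theta> s) = 0"
    and state_variance: "variance (\<theta> s) = 1 / \<tau>\<^sub>\<theta>"
    and public_noise: "distributed M lborel (\<eta> 0 s) (normal_density 0 (1 / sqrt \<tau>\<^sub>g))"
    and private_noise:
      "k \<in> {1..K} \<Longrightarrow> distributed M lborel (\<eta> k s) (normal_density 0 (1 / sqrt \<tau>\<^sub>y))"
    and noise_indep: "indep_vars (\<lambda>_. borel) (\<lambda>(k, s). \<eta> k s) ({0..K} \<times> UNIV)"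
    and state_noise_indep:
      "indep_set
         (sets (vimage_algebra (space M) (\<lambda>\<omega> s. \<theta> s \<omega>) (PiM UNIV (\<lambda>_. borel))))
         (sets (vimage_algebra (space M)
            (\<lambda>\<omega>. \<lambda>(k, s)\<in>{0..K} \<times> UNIV. \<eta> k s \<omega>)
            (PiM ({0..K} \<times> UNIV) (\<lambda>_. borel))))"

definition public_signal ::
  "('t \<Rightarrow> 'a \<Rightarrow> real) \<Rightarrow> (nat \<Rightarrow> 't \<Rightarrow> 'a \<Rightarrow> real) \<Rightarrow> 't \<Rightarrow> 'a \<Rightarrow> real" where
  "public_signal \<theta> \<eta> t \<omega> = \<theta> t \<omega> + \<eta> 0 t \<omega>"

definition private_signal ::
  "('t \<Rightarrow> 'a \<Rightarrow> real) \<Rightarrow> (nat \<Rightarrow> 't \<Rightarrow> 'a \<Rightarrow> real) \<Rightarrow> 't \<Rightarrow> nat \<Rightarrow> 'a \<Rightarrow> real" where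
  "private_signal \<theta> \<eta> t k \<omega> = \<theta> t \<omega> + \<eta> k t \<omega>"

definition cond_exp_given ::
  "'a measure \<Rightarrow> ('a \<Rightarrow> 'b::topological_space) \<Rightarrow> ('a \<Rightarrow> real) \<Rightarrow> 'a \<Rightarrow> real" where
  "cond_exp_given M Y X = real_cond_exp M (vimage_algebra (space M) Y borel) X"

definition posterior_mean ::
  "'a measure \<Rightarrow> ('t \<Rightarrow> 'a \<Rightarrow> real) \<Rightarrow> (nat \<Rightarrow> 't \<Rightarrow> 'a \<Rightarrow> real) \<Rightarrow> 't \<Rightarrow> nat \<Rightarrow> 'a \<Rightarrow> real" where
  "posterior_mean M \<theta> \<eta> t k =
     cond_exp_given M (\<lambda>\<omega>. (public_signal \<theta> \<eta> t \<omega>, private_signal \<theta> \<eta> t k \<omega>)) (\<theta> t)"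

definition share_vector :: "nat \<Rightarrow> (nat \<Rightarrow> real) \<Rightarrow> bool" where
  "share_vector K x \<longleftrightarrow> (\<forall>k\<in>{1..K}. 0 \<le> x k) \<and> (\<Sum>k=1..K. x k) = 1"

definition sum_largest :: "nat \<Rightarrow> nat \<Rightarrow> (nat \<Rightarrow> real) \<Rightarrow> real" where
  "sum_largest K n x = sum_list (take n (rev (sort (map x [1..<Suc K]))))"

definition majorizes :: "nat \<Rightarrow> (nat \<Rightarrow> real) \<Rightarrow> (nat \<Rightarrow> real) \<Rightarrow> bool" where
  "majorizes K x' x \<longleftrightarrow>
     (\<forall>n\<le>K. sum_largest K n x \<le> sum_largest K n x') \<and> sum_largest K K x' = sum_largest K K x"

definition dominant_share :: "nat \<Rightarrow> real \<Rightarrow> nat \<Rightarrow> real" where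
  "dominant_share K x\<^sub>D k = (if k = 1 then x\<^sub>D else (1 - x\<^sub>D) / (real K - 1))"

definition aggregate_action ::
  "nat \<Rightarrow> (nat \<Rightarrow> real) \<Rightarrow> (nat \<Rightarrow> 'a \<Rightarrow> real) \<Rightarrow> 'a \<Rightarrow> real" where
  "aggregate_action K x a \<omega> = (\<Sum>k=1..K. x k * a k \<omega>)"

definition affine_action ::
  "(nat \<Rightarrow> real) \<Rightarrow> (nat \<Rightarrow> real) \<Rightarrow> (nat \<Rightarrow> 'a \<Rightarrow> real) \<Rightarrow> nat \<Rightarrow> 'a \<Rightarrow> real" where
  "affine_action \<alpha> \<gamma> m k \<omega> = \<alpha> k + \<gamma> k * m k \<omega>"

text \<open>The argument \<open>e\<close> stands for the conditional expectation of the aggregate action, which a client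
  takes as given, and \<open>\<mu>\<close> for the realized posterior mean.\<close>

definition client_payoff ::
  "real \<Rightarrow> real \<Rightarrow> real \<Rightarrow> real \<Rightarrow> real \<Rightarrow> real \<Rightarrow> real \<Rightarrow> real \<Rightarrow> real" where
  "client_payoff c \<psi> \<xi> \<beta> d \<mu> e a = (a - c) * (\<psi> + \<xi> * \<mu> - \<beta> * a + d * e)"

text \<open>Optimality is required almost surely because conditional expectations are only determined
  up to null sets.\<close>

definition affine_delegated_equilibrium ::
  "'a measure \<Rightarrow> nat \<Rightarrow> (nat \<Rightarrow> 'a \<Rightarrow> real) \<Rightarrow> real \<Rightarrow> real \<Rightarrow> real \<Rightarrow> real \<Rightarrow> real \<Rightarrow>
   (nat \<Rightarrow> real) \<Rightarrow> (nat \<Rightarrow> real) \<Rightarrow> (nat \<Rightarrow> real) \<Rightarrow> bool" where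
  "affine_delegated_equilibrium M K m c \<psi> \<xi> \<beta> d x \<alpha> \<gamma> \<longleftrightarrow>
     (\<forall>k\<in>{1..K}. AE \<omega> in M. \<forall>b.
        client_payoff c \<psi> \<xi> \<beta> d (m k \<omega>)
          (cond_exp_given M (m k) (aggregate_action K x (affine_action \<alpha> \<gamma> m)) \<omega>) b
        \<le> client_payoff c \<psi> \<xi> \<beta> d (m k \<omega>)
          (cond_exp_given M (m k) (aggregate_action K x (affine_action \<alpha> \<gamma> m)) \<omega>)
          (affine_action \<alpha> \<gamma> m k \<omega>))"

definition strictly_increasing_inside :: "real \<Rightarrow> real \<Rightarrow> (real \<Rightarrow> real) \<Rightarrow> bool" where
  "strictly_increasing_inside l u f \<longleftrightarrow>
     strict_mono_on {l..u} f \<and>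
     (\<forall>z\<in>{l<..<u}. \<exists>D>0. (f has_real_derivative D) (at z))"

end

theory Submission
  imports Defs
begin

text \<open>
  A Bayes formula for densities identifies the posterior means: \<open>m\<^sub>k\<close> is almost surely a linear combination
  of the two signals, and \<open>m\<^sub>j\<close> given \<open>m\<^sub>k\<close> has conditional mean \<open>\<rho> m\<^sub>k\<close>. Since \<open>m\<^sub>k\<close> is not almost surely
  constant, comparing coefficients in the first-order conditions determines the equilibrium, and gives
  \<open>S = \<xi>\<Lambda> / (1 - d\<rho>\<Lambda>)\<close> and \<open>Q = (\<xi> / (1 - d\<rho>\<Lambda>))\<^sup>2 \<Sum>\<^sub>k \<phi>(x\<^sub>k)\<^sup>2\<close>, where \<open>\<phi>(z) = z / (2\<beta> - d(1 - \<rho>)z)\<close>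
  and \<open>\<Lambda> = \<Sum>\<^sub>k \<phi>(x\<^sub>k)\<close>. Both \<open>\<phi>\<close> and \<open>\<phi>\<^sup>2\<close> are strictly convex on the unit interval, so Karamata's inequality
  gives monotonicity under majorization, and in the dominant-provider family the derivative of
  \<open>\<Sum>\<^sub>k \<phi>(x\<^sub>k)\<close> is \<open>\<phi>'(x\<^sub>D) - \<phi>'((1 - x\<^sub>D) / (K - 1)) > 0\<close>.
\<close>

subsection \<open>Conditional expectations from densities\<close>

text \<open>Normality enters through the linearity of the two conditional means: second moments
  alone would give best linear predictors, not conditional expectations. Conditional expectations
  are fixed only up to null sets, so identities for posterior means hold almost surely; moments are
  computed for an explicit linear version and then transferred. Positivity of the denominators comes
  from d < \<beta>: the total feedback d(1 - \<rho>) + d\<rho> = d stays below 2\<beta>, which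
  yields both 2\<beta> - d(1 - \<rho>)x_k > 0 and d\<rho>\<Lambda> < 1. The equilibrium is given for
  share vectors, so along the dominant-provider family the objective is known on [1/K, 1]; its
  derivative is taken through explicit formulas that are differentiable at the endpoints as
  well.\<close>

text \<open>Finite intersections of members of the \<open>F i\<close> stay in the
  intersection-stable \<open>B\<close>, so independence of \<open>A\<close> and \<open>B\<close>
  splits off the one factor with index \<open>None\<close>.\<close>

lemma (in prob_space) indep_sets_insert_None:
  assumes F: "indep_sets F I" and AB: "indep_set A B"
    and sub: "\<And>i. i \<in> I \<Longrightarrow> F i \<subseteq> B" and B: "Int_stable B"
  shows "indep_sets (case_option A F) (insert None (Some ` I))"
proof (rule indep_setsI)
  fix i assume "i \<in> insert None (Some ` I)"
  then have "i = None \<or> (\<exists>k\<in>I. i = Some k)" by auto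
  moreover have "\<forall>i\<in>I. F i \<subseteq> events" "A \<subseteq> events"
    using indep_setD_ev1[OF AB] F unfolding indep_sets_def by blast+
  ultimately show "case_option A F i \<subseteq> events" by (elim disjE bexE) simp_all
next
  fix X J
  assume J: "J \<noteq> {}" "J \<subseteq> insert None (Some ` I)" "finite J" and X: "\<forall>j\<in>J. X j \<in> case_option A F j"
  define J' where "J' = {i. Some i \<in> J}"
  have J': "finite J'" "J' \<subseteq> I"
    using J unfolding J'_def by (auto intro: finite_vimageI[of J Some, unfolded vimage_def])
  have XF: "\<forall>i\<in>J'. X (Some i) \<in> F i"
    using X by (auto simp: J'_def)
  have Jeq: "J = (if None \<in> J then insert None (Some ` J') else Some ` J')"
    using J by (auto simp: J'_def)
  have prod': "prob (\<Inter>j\<in>J'. X (Some j)) = (\<Prod>j\<in>J'. prob (X (Some j)))" if "J' \<noteq> {}"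
    using indep_setsD[OF F J'(2) that J'(1)] XF by auto
  have inter: "(\<Inter>j\<in>J'. X (Some j)) \<in> B" if "J' \<noteq> {}"
    using J'(1) that J'(2) XF sub
  proof (induction J' rule: finite_ne_induct)
    case (insert i G)
    then show ?case using B[THEN Int_stableD] by auto
  qed auto
  show "prob (\<Inter>j\<in>J. X j) = (\<Prod>j\<in>J. prob (X j))"
  proof (cases "J' = {}")
    case True
    then show ?thesis using Jeq J(1) by (cases "None \<in> J") auto
  next
    case False
    have "prob (X None \<inter> (\<Inter>j\<in>J'. X (Some j))) = prob (X None) * prob (\<Inter>j\<in>J'. X (Some j))"
      if "None \<in> J"
      using indep_setD[OF AB _ inter[OF False]] X that by force
    then show ?thesis
      using prod'[OF False] J'(1)
      by (subst (1 2) Jeq) (auto simp: image_image prod.reindex)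
  qed
qed

text \<open>Disjoint blocks of an independent family have a product law, which stays a product when
  pushed forward in each coordinate. Independence is recorded by laws because the two images may
  have different types, a real state against a pair of noises, while \<open>indep_var\<close>
  relates variables with one value type.\<close>

lemma (in prob_space) indep_vars_imp_pair_distr:
  assumes "indep_vars M' X I" "A \<subseteq> I" "B \<subseteq> I" "A \<inter> B = {}"
    and f[measurable]: "f \<in> PiM A M' \<rightarrow>\<^sub>M N" and g[measurable]: "g \<in> PiM B M' \<rightarrow>\<^sub>M N'"
  shows "distr M N (\<lambda>\<omega>. f (\<lambda>i\<in>A. X i \<omega>)) \<Otimes>\<^sub>M distr M N' (\<lambda>\<omega>. g (\<lambda>i\<in>B. X i \<omega>)) =
    distr M (N \<Otimes>\<^sub>M N') (\<lambda>\<omega>. (f (\<lambda>i\<in>A. X i \<omega>), g (\<lambda>i\<in>B. X i \<omega>)))"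
proof -
  let ?X = "\<lambda>J \<omega>. \<lambda>i\<in>J. X i \<omega>"
  have ind: "indep_var (PiM A M') (?X A) (PiM B M') (?X B)"
    using indep_var_restrict[OF assms(1,4,2,3)] .
  then have [measurable]: "?X A \<in> M \<rightarrow>\<^sub>M PiM A M'" "?X B \<in> M \<rightarrow>\<^sub>M PiM B M'"
    by (blast dest: indep_var_rv1 indep_var_rv2)+
  have "prob_space (distr (distr M (PiM B M') (?X B)) N' g)"
    by (intro prob_space.prob_space_distr prob_space_distr) auto
  then have "distr (distr M (PiM A M') (?X A)) N f \<Otimes>\<^sub>M distr (distr M (PiM B M') (?X B)) N' g =
      distr (distr M (PiM A M' \<Otimes>\<^sub>M PiM B M') (\<lambda>\<omega>. (?X A \<omega>, ?X B \<omega>))) (N \<Otimes>\<^sub>M N') (\<lambda>(x, y). (f x, g y))"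
    using ind unfolding indep_var_distribution_eq
    by (subst pair_measure_distr) (auto intro: prob_space_imp_sigma_finite)
  then show ?thesis
    by (simp add: distr_distr comp_def)
qed

lemma (in prob_space) indep_vars_imp_indep_var:
  assumes "indep_vars M' X I" "A \<subseteq> I" "B \<subseteq> I" "A \<inter> B = {}"
    and "f \<in> PiM A M' \<rightarrow>\<^sub>M N" "g \<in> PiM B M' \<rightarrow>\<^sub>M N'"
  shows "indep_var N (\<lambda>\<omega>. f (\<lambda>i\<in>A. X i \<omega>)) N' (\<lambda>\<omega>. g (\<lambda>i\<in>B. X i \<omega>))"
  using indep_var_compose[OF indep_var_restrict[OF assms(1,4,2,3)] assms(5,6)]
  by (simp add: comp_def)

text \<open>Translation invariance of Lebesgue measure turns the joint law of \<open>(X, E)\<close> into that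
  of \<open>(X, h X + E)\<close>.\<close>

lemma (in prob_space) distributed_signal:
  fixes X :: "'a \<Rightarrow> real" and E :: "'a \<Rightarrow> 'b::euclidean_space"
  assumes X: "distributed M lborel X f" and E: "distributed M lborel E e"
    and indep: "distr M lborel X \<Otimes>\<^sub>M distr M lborel E = distr M (lborel \<Otimes>\<^sub>M lborel) (\<lambda>\<omega>. (X \<omega>, E \<omega>))"
    and h[measurable]: "h \<in> borel \<rightarrow>\<^sub>M borel"
  shows "distributed M (lborel \<Otimes>\<^sub>M lborel) (\<lambda>\<omega>. (X \<omega>, h (X \<omega>) + E \<omega>)) (\<lambda>(x, y). f x * e (y - h x))"
proof -
  have [measurable]: "f \<in> borel_measurable borel" "e \<in> borel_measurable borel"
      "X \<in> borel_measurable M" "E \<in> borel_measurable M"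
    using X E by (auto simp: distributed_def)
  have joint: "distr M (lborel \<Otimes>\<^sub>M lborel) (\<lambda>\<omega>. (X \<omega>, E \<omega>)) =
      density (lborel \<Otimes>\<^sub>M lborel) (\<lambda>(x, y). f x * e y)"
    using distributed_joint_indep'[OF _ _ X E indep] by (simp add: distributed_def sigma_finite_lborel)
  let ?T = "\<lambda>(x, z). (x, h x + z) :: real \<times> 'b"
  have q: "(\<lambda>(x, y). f x * e (y - h x)) \<in> borel_measurable (lborel \<Otimes>\<^sub>M lborel)"
    by measurable
  have XE: "(\<lambda>\<omega>. (X \<omega>, E \<omega>)) \<in> M \<rightarrow>\<^sub>M lborel \<Otimes>\<^sub>M lborel"
    by (intro measurable_Pair distributed_measurable[OF X] distributed_measurable[OF E])
  have T[measurable]: "?T \<in> lborel \<Otimes>\<^sub>M lborel \<rightarrow>\<^sub>M lborel \<Otimes>\<^sub>M lborel"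
    by measurable
  have "distr M (lborel \<Otimes>\<^sub>M lborel) (\<lambda>\<omega>. (X \<omega>, h (X \<omega>) + E \<omega>)) =
      density (lborel \<Otimes>\<^sub>M lborel) (\<lambda>(x, y). f x * e (y - h x))" (is "?L = ?R")
  proof (rule measure_eqI)
    fix A assume "A \<in> sets ?L"
    then have A[measurable]: "A \<in> sets (lborel \<Otimes>\<^sub>M lborel)" by simp
    have "emeasure ?L A = emeasure (distr (distr M (lborel \<Otimes>\<^sub>M lborel) (\<lambda>\<omega>. (X \<omega>, E \<omega>))) (lborel \<Otimes>\<^sub>M lborel) ?T) A"
      unfolding distr_distr[OF T XE] by (simp only: comp_def split)
    also have "\<dots> = (\<integral>\<^sup>+p. (case p of (x, z) \<Rightarrow> f x * e z) * indicator A (?T p) \<partial>(lborel \<Otimes>\<^sub>M lborel))"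
      unfolding joint
      using A T measurable_sets[OF T A] by (subst emeasure_distr, simp, simp, subst emeasure_density)
        (auto intro!: nn_integral_cong simp: space_pair_measure split: split_indicator)
    also have "\<dots> = (\<integral>\<^sup>+x. \<integral>\<^sup>+z. f x * e z * indicator A (x, h x + z) \<partial>lborel \<partial>lborel)"
      by (subst lborel.nn_integral_fst[symmetric]) auto
    also have "\<dots> = (\<integral>\<^sup>+x. \<integral>\<^sup>+y. f x * e (y - h x) * indicator A (x, y) \<partial>lborel \<partial>lborel)"
    proof (rule nn_integral_cong)
      fix x :: real
      show "(\<integral>\<^sup>+z. f x * e z * indicator A (x, h x + z) \<partial>lborel) =
          (\<integral>\<^sup>+y. f x * e (y - h x) * indicator A (x, y) \<partial>lborel)"
        by (subst (2) lborel_distr_plus[symmetric, of "h x"], subst nn_integral_distr) auto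
    qed
    also have "\<dots> = (\<integral>\<^sup>+p. (case p of (x, y) \<Rightarrow> f x * e (y - h x)) * indicator A p \<partial>(lborel \<Otimes>\<^sub>M lborel))"
      by (subst lborel.nn_integral_fst[symmetric]) auto
    also have "\<dots> = emeasure ?R A"
      by (rule emeasure_density[symmetric, OF q A])
    finally show "emeasure ?L A = emeasure ?R A" .
  qed simp
  moreover have "(\<lambda>\<omega>. (X \<omega>, h (X \<omega>) + E \<omega>)) \<in> M \<rightarrow>\<^sub>M lborel \<Otimes>\<^sub>M lborel"
    using measurable_compose[OF XE T] by (simp only: split)
  ultimately show ?thesis using q by (simp only: distributed_def simp_thms)
qed

text \<open>Bayes' formula without a normalising marginal: \<open>f x * e (y - h x)\<close> is the
  joint density of state and signal, and \<open>posterior\<close> makes \<open>l y\<close> the mean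
  of its unnormalised section at y. The map \<open>h\<close> into a Euclidean space covers one
  signal and a pair of signals alike.\<close>

lemma (in prob_space) expectation_posterior:
  fixes X :: "'a \<Rightarrow> real" and E :: "'a \<Rightarrow> 'b::euclidean_space"
  assumes X: "distributed M lborel X f" and E: "distributed M lborel E e"
    and nn: "\<And>x. 0 \<le> f x" "\<And>z. 0 \<le> e z"
    and indep: "distr M lborel X \<Otimes>\<^sub>M distr M lborel E = distr M (lborel \<Otimes>\<^sub>M lborel) (\<lambda>\<omega>. (X \<omega>, E \<omega>))"
    and h[measurable]: "h \<in> borel \<rightarrow>\<^sub>M borel"
    and l[measurable]: "l \<in> borel_measurable borel"
    and int: "integrable M X" "integrable M (\<lambda>\<omega>. l (h (X \<omega>) + E \<omega>))"
    and posterior: "\<And>y. (\<integral>x. f x * e (y - h x) * (x - l y) \<partial>lborel) = 0"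
    and B[measurable]: "B \<in> sets borel"
  shows "(\<integral>\<omega>. indicator B (h (X \<omega>) + E \<omega>) * X \<omega> \<partial>M) =
      (\<integral>\<omega>. indicator B (h (X \<omega>) + E \<omega>) * l (h (X \<omega>) + E \<omega>) \<partial>M)"
proof -
  have [measurable]: "X \<in> borel_measurable M" "E \<in> borel_measurable M"
    using X E by (auto simp: distributed_def)
  define G where "G = (\<lambda>(x, y). indicator B y * (x - l y))"
  have G[measurable]: "G \<in> borel_measurable (lborel \<Otimes>\<^sub>M lborel)"
    unfolding G_def by measurable
  let ?Z = "\<lambda>\<omega>. (X \<omega>, h (X \<omega>) + E \<omega>)"
  let ?q = "\<lambda>(x, y). f x * e (y - h x)"
  have Z: "distributed M (lborel \<Otimes>\<^sub>M lborel) ?Z ?q"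
    using distributed_signal[OF X E indep h] nn by (simp add: case_prod_beta' ennreal_mult)
  have i1: "integrable M (\<lambda>\<omega>. indicator B (h (X \<omega>) + E \<omega>) * X \<omega>)"
    and i2: "integrable M (\<lambda>\<omega>. indicator B (h (X \<omega>) + E \<omega>) * l (h (X \<omega>) + E \<omega>))"
    by (rule Bochner_Integration.integrable_bound[OF int(1)], auto split: split_indicator)
       (rule Bochner_Integration.integrable_bound[OF int(2)], auto split: split_indicator)
  have Gi: "integrable M (\<lambda>\<omega>. G (?Z \<omega>))"
    using Bochner_Integration.integrable_diff[OF i1 i2] by (simp add: G_def algebra_simps)
  then have qG: "integrable (lborel \<Otimes>\<^sub>M lborel) (\<lambda>p. ?q p * G p)"
    by (subst distributed_integrable[OF Z G]) (auto simp: nn)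
  have "(\<integral>\<omega>. G (?Z \<omega>) \<partial>M) = (\<integral>p. ?q p * G p \<partial>(lborel \<Otimes>\<^sub>M lborel))"
    by (rule distributed_integral[OF Z G, symmetric]) (auto simp: nn)
  \<comment> \<open>Fubini with the signal outside, since \<open>posterior\<close> concerns the
    integral over the state at a fixed signal.\<close>
  also have "\<dots> = (\<integral>y. (\<integral>x. ?q (x, y) * G (x, y) \<partial>lborel) \<partial>lborel)"
    using lborel_pair.integral_snd[of "\<lambda>x y. ?q (x, y) * G (x, y)"] qG
    by (simp add: case_prod_beta')
  also have "\<dots> = (\<integral>y. indicator B y * (\<integral>x. f x * e (y - h x) * (x - l y) \<partial>lborel) \<partial>(lborel :: 'b measure))"
    by (intro Bochner_Integration.integral_cong refl) (auto simp: G_def split: split_indicator)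
  also have "\<dots> = 0" by (simp add: posterior)
  finally show ?thesis
    using i1 i2 by (simp add: G_def algebra_simps)
qed

text \<open>The sigma-algebra generated by \<open>Y\<close> consists of the preimages of Borel sets,
  so it suffices to test against indicators in the value space.\<close>

lemma (in prob_space) cond_exp_given_charact:
  assumes Y[measurable]: "Y \<in> M \<rightarrow>\<^sub>M borel" and X: "integrable M X"
    and l[measurable]: "l \<in> borel_measurable borel" and lY: "integrable M (\<lambda>\<omega>. l (Y \<omega>))"
    and eq: "\<And>B. B \<in> sets borel \<Longrightarrow>
      (\<integral>\<omega>. indicator B (Y \<omega>) * X \<omega> \<partial>M) = (\<integral>\<omega>. indicator B (Y \<omega>) * l (Y \<omega>) \<partial>M)"
  shows "AE \<omega> in M. cond_exp_given M Y X \<omega> = l (Y \<omega>)"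
proof -
  let ?F = "vimage_algebra (space M) Y borel"
  have sets: "sets ?F = {Y -` B \<inter> space M | B. B \<in> sets borel}"
    by (rule sets_vimage_algebra2) simp
  interpret F: finite_measure_subalgebra M ?F
    by unfold_locales (auto simp: subalgebra_def sets measurable_sets[OF Y])
  have YF: "Y \<in> ?F \<rightarrow>\<^sub>M borel" by (rule measurable_vimage_algebra1) simp
  show ?thesis unfolding cond_exp_given_def
  proof (rule F.real_cond_exp_charact[OF _ X lY])
    fix A assume "A \<in> sets ?F"
    then obtain B where B: "B \<in> sets borel" "A = Y -` B \<inter> space M" by (auto simp: sets)
    have *: "(\<integral>\<omega>\<in>A. g \<omega> \<partial>M) = (\<integral>\<omega>. indicator B (Y \<omega>) * g \<omega> \<partial>M)" for g :: "'a \<Rightarrow> real"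
      unfolding set_lebesgue_integral_def
      by (rule Bochner_Integration.integral_cong) (auto simp: B(2) split: split_indicator)
    show "(\<integral>\<omega>\<in>A. X \<omega> \<partial>M) = (\<integral>\<omega>\<in>A. l (Y \<omega>) \<partial>M)"
      unfolding * by (rule eq[OF B(1)])
  qed (rule measurable_compose[OF YF l])
qed

lemma cond_exp_given_measurable [measurable]:
  "cond_exp_given M Y X \<in> borel_measurable M"
  unfolding cond_exp_given_def
  by (rule borel_measurable_cond_exp2)

section \<open>Bayesian updating with normal densities\<close>

text \<open>Completing the square adds the precisions and averages the centres with precision
  weights. The factor \<open>C\<close> depends on the centres but not on x; its value is left open
  because it will multiply an integral that vanishes.\<close>

lemma normal_density_mult:
  assumes "\<tau> > 0" "\<tau>' > 0"
  obtains C where "\<And>x. normal_density \<mu> (1 / sqrt \<tau>) x * normal_density \<mu>' (1 / sqrt \<tau>') x =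
    C * normal_density ((\<tau> * \<mu> + \<tau>' * \<mu>') / (\<tau> + \<tau>')) (1 / sqrt (\<tau> + \<tau>')) x"
proof -
  have nd: "normal_density a (1 / sqrt s) x = 1 / sqrt (2 * pi / s) * exp (- s * (x - a)\<^sup>2 / 2)"
    if "s > 0" for a s x :: real
    using that by (simp add: normal_density_def power_divide)
  define \<nu> where "\<nu> = (\<tau> * \<mu> + \<tau>' * \<mu>') / (\<tau> + \<tau>')"
  \<comment> \<open>The remainder of completing the square, free of x.\<close>
  define c where "c = \<tau> * \<tau>' / (\<tau> + \<tau>') * (\<mu> - \<mu>')\<^sup>2"
  have \<nu>: "(\<tau> + \<tau>') * \<nu> = \<tau> * \<mu> + \<tau>' * \<mu>'" and c: "(\<tau> + \<tau>') * c = \<tau> * \<tau>' * (\<mu> - \<mu>')\<^sup>2"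
    using assms by (auto simp: \<nu>_def c_def)
  have sq: "\<tau> * (x - \<mu>)\<^sup>2 + \<tau>' * (x - \<mu>')\<^sup>2 = (\<tau> + \<tau>') * (x - \<nu>)\<^sup>2 + c" for x
  proof -
    \<comment> \<open>Clearing the denominator \<tau> + \<tau>' leaves a polynomial identity, within
      reach of \<open>algebra\<close>.\<close>
    have "(\<tau> + \<tau>') * (\<tau> * (x - \<mu>)\<^sup>2 + \<tau>' * (x - \<mu>')\<^sup>2) =
        ((\<tau> + \<tau>') * x - (\<tau> * \<mu> + \<tau>' * \<mu>'))\<^sup>2 + \<tau> * \<tau>' * (\<mu> - \<mu>')\<^sup>2"
      by algebra
    also have "\<dots> = ((\<tau> + \<tau>') * x - (\<tau> + \<tau>') * \<nu>)\<^sup>2 + (\<tau> + \<tau>') * c"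
      by (simp only: \<nu> c)
    also have "\<dots> = (\<tau> + \<tau>') * ((\<tau> + \<tau>') * (x - \<nu>)\<^sup>2 + c)"
      by algebra
    finally show ?thesis using assms by simp
  qed
  define C where "C = sqrt (2 * pi / (\<tau> + \<tau>')) / (sqrt (2 * pi / \<tau>) * sqrt (2 * pi / \<tau>')) * exp (- c / 2)"
  have "normal_density \<mu> (1 / sqrt \<tau>) x * normal_density \<mu>' (1 / sqrt \<tau>') x =
    C * normal_density \<nu> (1 / sqrt (\<tau> + \<tau>')) x" for x
  proof -
    have "exp (- \<tau> * (x - \<mu>)\<^sup>2 / 2) * exp (- \<tau>' * (x - \<mu>')\<^sup>2 / 2) =
        exp (- (\<tau> * (x - \<mu>)\<^sup>2 + \<tau>' * (x - \<mu>')\<^sup>2) / 2)"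
      by (simp add: exp_add[symmetric] field_simps)
    also have "\<dots> = exp (- c / 2) * exp (- (\<tau> + \<tau>') * (x - \<nu>)\<^sup>2 / 2)"
      unfolding sq by (simp add: exp_add[symmetric] field_simps)
    finally have "exp (- \<tau> * (x - \<mu>)\<^sup>2 / 2) * exp (- \<tau>' * (x - \<mu>')\<^sup>2 / 2) =
        exp (- c / 2) * exp (- (\<tau> + \<tau>') * (x - \<nu>)\<^sup>2 / 2)" .
    moreover have "sqrt (2 * pi / (\<tau> + \<tau>')) > 0" using assms by simp
    ultimately show ?thesis
      using assms by (simp add: nd C_def)
  qed
  then show ?thesis using that unfolding \<nu>_def by blast
qed

text \<open>Read as a function of the state x, the noise density at y - x is a likelihood centred at
  the signal y.\<close>

lemma normal_density_diff: "normal_density 0 \<sigma> (y - x) = normal_density y \<sigma> x"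
  by (simp add: normal_density_def power2_commute)

lemma (in prob_space) expectation_posterior_normal:
  fixes X E :: "'a \<Rightarrow> real"
  assumes \<tau>: "\<tau> > 0" "\<tau>' > 0"
    and X: "distributed M lborel X (normal_density 0 (1 / sqrt \<tau>))"
    and E: "distributed M lborel E (normal_density 0 (1 / sqrt \<tau>'))"
    and indep: "indep_var borel X borel E" and int: "integrable M X" "integrable M E"
    and B: "B \<in> sets borel"
  shows "(\<integral>\<omega>. indicator B (X \<omega> + E \<omega>) * X \<omega> \<partial>M) =
      \<tau>' / (\<tau> + \<tau>') * (\<integral>\<omega>. indicator B (X \<omega> + E \<omega>) * (X \<omega> + E \<omega>) \<partial>M)"
proof -
  have post: "(\<integral>x. normal_density 0 (1 / sqrt \<tau>) x * normal_density 0 (1 / sqrt \<tau>') (y - x) *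
      (x - \<tau>' / (\<tau> + \<tau>') * y) \<partial>lborel) = 0" for y
  proof -
    obtain C where "\<And>x. normal_density 0 (1 / sqrt \<tau>) x * normal_density 0 (1 / sqrt \<tau>') (y - x) =
        C * normal_density (\<tau>' / (\<tau> + \<tau>') * y) (1 / sqrt (\<tau> + \<tau>')) x"
      using normal_density_mult[OF \<tau>, of 0 y] by (auto simp: normal_density_diff)
    then show ?thesis
      \<comment> \<open>The last argument 0 selects the central moment of order 2 * 0 + 1 = 1, which
        vanishes.\<close>
      using integral_normal_moment_odd[of "1 / sqrt (\<tau> + \<tau>')" "\<tau>' / (\<tau> + \<tau>') * y" 0] \<tau>
      by (simp add: mult.assoc)
  qed
  have "indep_var lborel X lborel E"
    using indep by (simp add: indep_var_eq)
  then have "distr M lborel X \<Otimes>\<^sub>M distr M lborel E = distr M (lborel \<Otimes>\<^sub>M lborel) (\<lambda>\<omega>. (X \<omega>, E \<omega>))"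
    by (simp add: indep_var_distribution_eq)
  from expectation_posterior[OF X E _ _ this, of "\<lambda>x. x" "\<lambda>y. \<tau>' / (\<tau> + \<tau>') * y", OF _ _ _ _ _ _ post B]
  show ?thesis
    using int by (simp add: mult.left_commute[of _ \<tau>'])
qed

text \<open>The signals are absorbed one at a time: the posterior after the first is the prior for
  the second.\<close>

lemma (in prob_space) expectation_posterior_normal2:
  fixes X E E' :: "'a \<Rightarrow> real"
  assumes \<tau>: "\<tau> > 0" "\<tau>' > 0" "\<tau>'' > 0"
    and X: "distributed M lborel X (normal_density 0 (1 / sqrt \<tau>))"
    and E: "distributed M lborel E (normal_density 0 (1 / sqrt \<tau>'))"
    and E': "distributed M lborel E' (normal_density 0 (1 / sqrt \<tau>''))"
    and indep: "distr M lborel X \<Otimes>\<^sub>M distr M lborel (\<lambda>\<omega>. (E \<omega>, E' \<omega>)) =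
        distr M (lborel \<Otimes>\<^sub>M lborel) (\<lambda>\<omega>. (X \<omega>, E \<omega>, E' \<omega>))"
      "indep_var borel E borel E'"
    and int: "integrable M X" "integrable M E" "integrable M E'"
    and B: "B \<in> sets borel"
  shows "(\<integral>\<omega>. indicator B (X \<omega> + E \<omega>, X \<omega> + E' \<omega>) * X \<omega> \<partial>M) =
      (\<integral>\<omega>. indicator B (X \<omega> + E \<omega>, X \<omega> + E' \<omega>) *
        ((\<tau>' * (X \<omega> + E \<omega>) + \<tau>'' * (X \<omega> + E' \<omega>)) / (\<tau> + \<tau>' + \<tau>'')) \<partial>M)"
proof -
  let ?e = "\<lambda>(y, z). normal_density 0 (1 / sqrt \<tau>') y * normal_density 0 (1 / sqrt \<tau>'') z"
  let ?l = "\<lambda>(y, z). (\<tau>' * y + \<tau>'' * z) / (\<tau> + \<tau>' + \<tau>'')"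
  have "indep_var lborel E lborel E'"
    using indep(2) by (simp add: indep_var_eq)
  from distributed_joint_indep[OF _ _ E E' this]
  have EE: "distributed M lborel (\<lambda>\<omega>. (E \<omega>, E' \<omega>)) ?e"
    by (simp add: lborel_prod sigma_finite_lborel ennreal_mult case_prod_beta')
  have post: "(\<integral>x. normal_density 0 (1 / sqrt \<tau>) x * ?e (p - (x, x)) * (x - ?l p) \<partial>lborel) = 0" for p
  proof -
    obtain y z where p: "p = (y, z)" by fastforce
    obtain C where C: "\<And>x. normal_density 0 (1 / sqrt \<tau>) x * normal_density y (1 / sqrt \<tau>') x =
        C * normal_density (\<tau>' * y / (\<tau> + \<tau>')) (1 / sqrt (\<tau> + \<tau>')) x"
      using normal_density_mult[OF \<tau>(1,2), of 0 y] by auto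
    obtain C' where C': "\<And>x. normal_density (\<tau>' * y / (\<tau> + \<tau>')) (1 / sqrt (\<tau> + \<tau>')) x * normal_density z (1 / sqrt \<tau>'') x =
        C' * normal_density (?l p) (1 / sqrt (\<tau> + \<tau>' + \<tau>'')) x"
      using normal_density_mult[of "\<tau> + \<tau>'" \<tau>'' "\<tau>' * y / (\<tau> + \<tau>')" z] \<tau> by (auto simp: p)
    have "normal_density 0 (1 / sqrt \<tau>) x * ?e (p - (x, x)) = C * C' * normal_density (?l p) (1 / sqrt (\<tau> + \<tau>' + \<tau>'')) x" for x
      using C[of x] C'[of x] by (simp add: p normal_density_diff) (metis mult.assoc)
    then show ?thesis
      using integral_normal_moment_odd[of "1 / sqrt (\<tau> + \<tau>' + \<tau>'')" "?l p" 0] \<tau>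
      by (simp add: mult.assoc)
  qed
  have "?l \<in> borel_measurable borel"
    by (subst borel_prod[symmetric]) measurable
  from expectation_posterior[OF X EE _ _ indep(1) _ this, of "\<lambda>x. (x, x)", OF _ _ _ _ _ post B]
  show ?thesis
    using int by (simp add: case_prod_beta')
qed

lemma (in prob_space) normal_moments:
  assumes \<tau>: "\<tau> > 0" and X: "distributed M lborel X (normal_density 0 (1 / sqrt \<tau>))"
  shows "X \<in> borel_measurable M" "integrable M X" "integrable M (\<lambda>\<omega>. (X \<omega>)\<^sup>2)"
    "expectation X = 0" "expectation (\<lambda>\<omega>. (X \<omega>)\<^sup>2) = 1 / \<tau>"
proof -
  have \<sigma>: "0 < 1 / sqrt \<tau>" using \<tau> by simp
  show "X \<in> borel_measurable M" using distributed_measurable[OF X] by simp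
  show "integrable M X"
    using distributed_integrable[OF X, of "\<lambda>x. x"] integrable_normal_moment_nz_1[OF \<sigma>, of 0] by simp
  show "integrable M (\<lambda>\<omega>. (X \<omega>)\<^sup>2)"
    using distributed_integrable[OF X, of "\<lambda>x. x\<^sup>2"] integrable_normal_moment[OF \<sigma>, of 0 2] by simp
  show e: "expectation X = 0" by (rule normal_distributed_expectation[OF \<sigma> X])
  show "expectation (\<lambda>\<omega>. (X \<omega>)\<^sup>2) = 1 / \<tau>"
    using normal_distributed_variance[OF \<sigma> X] \<tau> by (simp add: e power_divide)
qed

lemma integrable_mult_of_squares:
  fixes X Y :: "'a \<Rightarrow> real"
  assumes [measurable]: "X \<in> borel_measurable M" "Y \<in> borel_measurable M"
    and "integrable M (\<lambda>\<omega>. (X \<omega>)\<^sup>2)" "integrable M (\<lambda>\<omega>. (Y \<omega>)\<^sup>2)"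
  shows "integrable M (\<lambda>\<omega>. X \<omega> * Y \<omega>)"
proof (rule Bochner_Integration.integrable_bound[OF Bochner_Integration.integrable_add[OF assms(3,4)]])
  have "\<bar>x * y\<bar> \<le> x\<^sup>2 + y\<^sup>2" for x y :: real
  proof -
    have "0 \<le> (\<bar>x\<bar> - \<bar>y\<bar>)\<^sup>2" by simp
    then have "2 * (\<bar>x\<bar> * \<bar>y\<bar>) \<le> x\<^sup>2 + y\<^sup>2" by (simp add: power2_diff)
    moreover have "0 \<le> \<bar>x\<bar> * \<bar>y\<bar>" by simp
    ultimately show ?thesis unfolding abs_mult by linarith
  qed
  then show "AE \<omega> in M. norm (X \<omega> * Y \<omega>) \<le> norm ((X \<omega>)\<^sup>2 + (Y \<omega>)\<^sup>2)"
    by simp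
qed simp

subsection \<open>Posterior means\<close>

context scarcity_signals
begin

text \<open>Closed form, in the precisions alone, of the number that the theorem introduces as a
  variance of a posterior mean; \<open>signal_correlation\<close> does the same for \<rho>.\<close>

definition signal_variance :: real where
  "signal_variance = (\<tau>\<^sub>g + \<tau>\<^sub>y) / (\<tau>\<^sub>\<theta> * (\<tau>\<^sub>\<theta> + \<tau>\<^sub>g + \<tau>\<^sub>y))"

definition signal_correlation :: real where
  "signal_correlation = 1 - \<tau>\<^sub>\<theta> * \<tau>\<^sub>y / ((\<tau>\<^sub>g + \<tau>\<^sub>y) * (\<tau>\<^sub>\<theta> + \<tau>\<^sub>g + \<tau>\<^sub>y))"

text \<open>Precision-weighted mean of the two signals and the prior mean 0. It is defined pointwise
  and serves as the concrete version of the posterior mean in which moments are computed.\<close>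

definition linear_estimate :: "'t \<Rightarrow> nat \<Rightarrow> 'a \<Rightarrow> real" where
  "linear_estimate t k \<omega> =
    (\<tau>\<^sub>g * public_signal \<theta> \<eta> t \<omega> + \<tau>\<^sub>y * private_signal \<theta> \<eta> t k \<omega>) / (\<tau>\<^sub>\<theta> + \<tau>\<^sub>g + \<tau>\<^sub>y)"

lemma signal_variance_pos: "signal_variance > 0"
  using precisions_pos by (simp add: signal_variance_def)

lemma signal_correlation_bounds: "0 < signal_correlation" "signal_correlation < 1"
proof -
  have "\<tau>\<^sub>\<theta> * \<tau>\<^sub>y < (\<tau>\<^sub>g + \<tau>\<^sub>y) * (\<tau>\<^sub>\<theta> + \<tau>\<^sub>g + \<tau>\<^sub>y)"
    using precisions_pos by (simp add: algebra_simps add_pos_pos)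
  then show "0 < signal_correlation" "signal_correlation < 1"
    using precisions_pos by (simp_all add: signal_correlation_def)
qed

text \<open>Splits the estimate into independent parts: the first two are common to all providers,
  the last is private.\<close>

lemma linear_estimate_eq:
  "linear_estimate t k \<omega> = (\<tau>\<^sub>g + \<tau>\<^sub>y) / (\<tau>\<^sub>\<theta> + \<tau>\<^sub>g + \<tau>\<^sub>y) * \<theta> t \<omega> +
    \<tau>\<^sub>g / (\<tau>\<^sub>\<theta> + \<tau>\<^sub>g + \<tau>\<^sub>y) * \<eta> 0 t \<omega> + \<tau>\<^sub>y / (\<tau>\<^sub>\<theta> + \<tau>\<^sub>g + \<tau>\<^sub>y) * \<eta> k t \<omega>"
proof -
  define T where "T = \<tau>\<^sub>\<theta> + \<tau>\<^sub>g + \<tau>\<^sub>y"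
  have "T > 0" using precisions_pos by (simp add: T_def)
  then show ?thesis
    unfolding linear_estimate_def public_signal_def private_signal_def T_def[symmetric]
    by (simp add: field_simps)
qed

text \<open>The summands are the variances of the three independent parts of
  \<open>linear_estimate\<close>; without the private one, what remains is the covariance between
  two providers.\<close>

lemma variance_decomposition:
  fixes a b e :: real
  defines "a \<equiv> (\<tau>\<^sub>g + \<tau>\<^sub>y) / (\<tau>\<^sub>\<theta> + \<tau>\<^sub>g + \<tau>\<^sub>y)" and "b \<equiv> \<tau>\<^sub>g / (\<tau>\<^sub>\<theta> + \<tau>\<^sub>g + \<tau>\<^sub>y)" and "e \<equiv> \<tau>\<^sub>y / (\<tau>\<^sub>\<theta> + \<tau>\<^sub>g + \<tau>\<^sub>y)"
  shows "a\<^sup>2 / \<tau>\<^sub>\<theta> + b\<^sup>2 / \<tau>\<^sub>g + e\<^sup>2 / \<tau>\<^sub>y = signal_variance"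
    and "a\<^sup>2 / \<tau>\<^sub>\<theta> + b\<^sup>2 / \<tau>\<^sub>g = signal_correlation * signal_variance"
proof -
  define T where "T = \<tau>\<^sub>\<theta> + \<tau>\<^sub>g + \<tau>\<^sub>y"
  have T: "T > 0" using precisions_pos by (simp add: T_def)
  have "a\<^sup>2 / \<tau>\<^sub>\<theta> + b\<^sup>2 / \<tau>\<^sub>g + e\<^sup>2 / \<tau>\<^sub>y = ((\<tau>\<^sub>g + \<tau>\<^sub>y)\<^sup>2 / \<tau>\<^sub>\<theta> + (\<tau>\<^sub>g + \<tau>\<^sub>y)) / T\<^sup>2"
    using precisions_pos T unfolding a_def b_def e_def T_def[symmetric]
    by (simp add: power_divide add_divide_distrib[of _ _ "T\<^sup>2"]) (simp add: power2_eq_square)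
  also have "(\<tau>\<^sub>g + \<tau>\<^sub>y)\<^sup>2 / \<tau>\<^sub>\<theta> + (\<tau>\<^sub>g + \<tau>\<^sub>y) = (\<tau>\<^sub>g + \<tau>\<^sub>y) * T / \<tau>\<^sub>\<theta>"
    using precisions_pos by (simp add: T_def power2_eq_square field_simps)
  also have "\<dots> / T\<^sup>2 = signal_variance"
    using T by (simp add: signal_variance_def T_def[symmetric] power2_eq_square)
  finally show V: "a\<^sup>2 / \<tau>\<^sub>\<theta> + b\<^sup>2 / \<tau>\<^sub>g + e\<^sup>2 / \<tau>\<^sub>y = signal_variance" .
  have "(1 - signal_correlation) * signal_variance =
      \<tau>\<^sub>\<theta> * \<tau>\<^sub>y / ((\<tau>\<^sub>g + \<tau>\<^sub>y) * T) * ((\<tau>\<^sub>g + \<tau>\<^sub>y) / (\<tau>\<^sub>\<theta> * T))"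
    by (simp add: signal_correlation_def signal_variance_def T_def)
  also have "\<dots> = e\<^sup>2 / \<tau>\<^sub>y"
    using precisions_pos T add_pos_pos[OF precisions_pos(2,3)]
    unfolding e_def T_def[symmetric] by (simp add: power2_eq_square)
  finally show "a\<^sup>2 / \<tau>\<^sub>\<theta> + b\<^sup>2 / \<tau>\<^sub>g = signal_correlation * signal_variance"
    using V by (simp add: algebra_simps)
qed

section \<open>Law and joint independence of state and noises at one time\<close>

text \<open>One coordinate of a Gaussian process is normal or almost surely constant. A constant of
  mean 0 has variance 0, against the positive \<open>1 / \<tau>\<^sub>\<theta>\<close>; in the
  normal case mean and variance fix the parameters.\<close>

lemma state_normal: "distributed M lborel (\<theta> s) (normal_density 0 (1 / sqrt \<tau>\<^sub>\<theta>))"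
proof -
  have "gaussian_variable M (\<theta> s)"
    using state_gaussian[unfolded gaussian_process_def, rule_format, of "{s}" "\<lambda>_. 1"] by simp
  then consider \<mu> \<sigma> where "\<sigma> > 0" "distributed M lborel (\<theta> s) (normal_density \<mu> \<sigma>)"
    | \<mu> where "\<theta> s \<in> borel_measurable M" "AE \<omega> in M. \<theta> s \<omega> = \<mu>"
    unfolding gaussian_variable_def by blast
  then show ?thesis
  proof cases
    case 1
    have "\<mu> = 0" using normal_distributed_expectation[OF 1] state_mean by simp
    moreover have "\<sigma>\<^sup>2 = (1 / sqrt \<tau>\<^sub>\<theta>)\<^sup>2"
      using normal_distributed_variance[OF 1] state_variance[of s] precisions_pos by (simp add: power_divide)
    then have "\<sigma> = 1 / sqrt \<tau>\<^sub>\<theta>"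
      using 1(1) precisions_pos by (subst (asm) power2_eq_iff_nonneg) auto
    ultimately show ?thesis using 1(2) by simp
  next
    case 2
    have "variance (\<theta> s) = (\<integral>\<omega>. \<mu>\<^sup>2 \<partial>M)"
      using 2 by (intro integral_cong_AE) (auto simp: state_mean)
    moreover have "expectation (\<theta> s) = (\<integral>\<omega>. \<mu> \<partial>M)"
      using 2 by (intro integral_cong_AE) auto
    ultimately show ?thesis
      using state_variance[of s] state_mean[of s] precisions_pos by (simp add: prob_space)
  qed
qed

text \<open>The hypotheses separate the whole path of the state from the whole noise family.
  Evaluation at time \<open>t\<close> is measurable on the product spaces, so time-\<open>t\<close>
  events belong to the path sigma-algebras. Index \<open>None\<close> is the state,
  \<open>Some k\<close> the noise with index \<open>k\<close>.\<close>

lemma signals_indep: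
  "indep_vars (\<lambda>_. borel) (case_option (\<theta> t) (\<lambda>k. \<eta> k t)) (insert None (Some ` {0..K}))"
proof -
  let ?S = "sets (vimage_algebra (space M) (\<lambda>\<omega> s. \<theta> s \<omega>) (PiM UNIV (\<lambda>_. borel)))"
  let ?N = "vimage_algebra (space M) (\<lambda>\<omega>. \<lambda>(k, s)\<in>{0..K} \<times> UNIV. \<eta> k s \<omega>)
            (PiM ({0..K} \<times> UNIV) (\<lambda>_. borel))"
  let ?F = "\<lambda>X. {X -` A \<inter> space M | A. A \<in> sets (borel :: real measure)}"
  have nrv: "\<And>k. k \<in> {0..K} \<Longrightarrow> \<eta> k t \<in> borel_measurable M"
    and nind: "indep_sets (\<lambda>(k, s). ?F (\<eta> k s)) ({0..K} \<times> UNIV)"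
    using noise_indep unfolding indep_vars_def2 by (auto simp: case_prod_beta')
  \<comment> \<open>Reindexing along the injection that sends k to (k, t) restricts the noises to
    the fixed time.\<close>
  have ind: "indep_sets (\<lambda>k. ?F (\<eta> k t)) {0..K}"
  proof (rule indep_setsI)
    fix k assume "k \<in> {0..K}"
    then show "?F (\<eta> k t) \<subseteq> events" using nrv by (auto intro: measurable_sets)
  next
    fix A J assume J: "J \<noteq> {}" "J \<subseteq> {0..K}" "finite J" "\<forall>j\<in>J. A j \<in> ?F (\<eta> j t)"
    then have "prob (\<Inter>p\<in>(\<lambda>k. (k, t)) ` J. A (fst p)) = (\<Prod>p\<in>(\<lambda>k. (k, t)) ` J. prob (A (fst p)))"
      by (intro indep_setsD[OF nind]) auto
    then show "prob (\<Inter>j\<in>J. A j) = (\<Prod>j\<in>J. prob (A j))"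
      by (subst (asm) prod.reindex) (auto intro: inj_onI simp: image_image)
  qed
  have S: "?F (\<theta> t) \<subseteq> ?S"
  proof safe
    fix A :: "real set" assume "A \<in> sets borel"
    then have "(\<lambda>f. f t) -` A \<inter> space (PiM UNIV (\<lambda>_. borel)) \<in> sets (PiM UNIV (\<lambda>_. borel))"
      by (intro measurable_sets[OF measurable_component_singleton]) auto
    from in_vimage_algebra[OF this, of "\<lambda>\<omega> s. \<theta> s \<omega>" "space M"]
    show "\<theta> t -` A \<inter> space M \<in> ?S"
      by (simp add: space_PiM vimage_def)
  qed
  have N: "?F (\<eta> k t) \<subseteq> sets ?N" if k: "k \<in> {0..K}" for k
  proof safe
    fix A :: "real set" assume "A \<in> sets borel"
    then have "(\<lambda>f. f (k, t)) -` A \<inter> space (PiM ({0..K} \<times> UNIV) (\<lambda>_. borel)) \<in>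
        sets (PiM ({0..K} \<times> UNIV) (\<lambda>_. borel))"
      using k by (intro measurable_sets[OF measurable_component_singleton]) auto
    from in_vimage_algebra[OF this, of "\<lambda>\<omega>. \<lambda>(k, s)\<in>{0..K} \<times> UNIV. \<eta> k s \<omega>" "space M"]
    show "\<eta> k t -` A \<inter> space M \<in> sets ?N"
      using k by (simp add: space_PiM vimage_def)
  qed
  \<comment> \<open>The state enters with its full path sigma-algebra, as in the hypothesis, and is
    cut down to time \<open>t\<close> afterwards.\<close>
  have "indep_sets (case_option ?S (\<lambda>k. ?F (\<eta> k t))) (insert None (Some ` {0..K}))"
    by (rule indep_sets_insert_None[OF ind state_noise_indep N]) (auto intro: sets.Int_stable)
  then have "indep_sets (\<lambda>i. ?F (case_option (\<theta> t) (\<lambda>k. \<eta> k t) i)) (insert None (Some ` {0..K}))"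
  proof (rule indep_sets_mono_sets)
    fix i :: "nat option" assume "i \<in> insert None (Some ` {0..K})"
    then show "?F (case_option (\<theta> t) (\<lambda>k. \<eta> k t) i) \<subseteq> case_option ?S (\<lambda>k. ?F (\<eta> k t)) i"
      by (elim insertE imageE) (simp_all only: option.case S subset_refl)
  qed
  moreover have "\<theta> t \<in> borel_measurable M"
    using distributed_measurable[OF state_normal] by simp
  ultimately show ?thesis
    unfolding indep_vars_def2 using nrv by auto
qed

lemmas state_moments = normal_moments[OF precisions_pos(1) state_normal]
lemmas public_moments = normal_moments[OF precisions_pos(2) public_noise]
lemmas private_moments = normal_moments[OF precisions_pos(3) private_noise]

lemma state_noise_indep_var: "k \<in> {0..K} \<Longrightarrow> indep_var borel (\<theta> t) borel (\<eta> k t)"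
  using indep_vars_imp_indep_var[OF signals_indep[of t], of "{None}" "{Some k}" "\<lambda>f. f None" borel "\<lambda>f. f (Some k)" borel]
  by simp

lemma noise_indep_var:
  "k \<in> {0..K} \<Longrightarrow> j \<in> {0..K} \<Longrightarrow> k \<noteq> j \<Longrightarrow> indep_var borel (\<eta> k t) borel (\<eta> j t)"
  using indep_vars_imp_indep_var[OF signals_indep[of t], of "{Some k}" "{Some j}" "\<lambda>f. f (Some k)" borel "\<lambda>f. f (Some j)" borel]
  by simp

lemma posterior_mean_measurable [measurable]:
  "posterior_mean M \<theta> \<eta> t k \<in> borel_measurable M"
  unfolding posterior_mean_def by simp

text \<open>Distinct components are independent and centred, so among their products only the
  squares have nonzero mean.\<close>

lemma linear_estimate_moments:
  assumes k: "k \<in> {1..K}"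
  shows "linear_estimate t k \<in> borel_measurable M" "integrable M (linear_estimate t k)"
    "integrable M (\<lambda>\<omega>. (linear_estimate t k \<omega>)\<^sup>2)"
    "expectation (linear_estimate t k) = 0"
    "expectation (\<lambda>\<omega>. linear_estimate t k \<omega> * \<theta> t \<omega>) = signal_variance"
    "j \<in> {1..K} \<Longrightarrow> expectation (\<lambda>\<omega>. linear_estimate t k \<omega> * linear_estimate t j \<omega>) =
      (if j = k then 1 else signal_correlation) * signal_variance"
proof -
  define T where "T = \<tau>\<^sub>\<theta> + \<tau>\<^sub>g + \<tau>\<^sub>y"
  have T: "T > 0" using precisions_pos by (simp add: T_def)
  define a b e where "a = (\<tau>\<^sub>g + \<tau>\<^sub>y) / T" and "b = \<tau>\<^sub>g / T" and "e = \<tau>\<^sub>y / T"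
  have lin: "linear_estimate t k \<omega> = a * \<theta> t \<omega> + b * \<eta> 0 t \<omega> + e * \<eta> k t \<omega>" for k \<omega>
    by (simp add: linear_estimate_eq a_def b_def e_def T_def)
  note [measurable] = state_moments(1) public_moments(1)
  have [measurable]: "\<eta> k t \<in> borel_measurable M" if "k \<in> {1..K}" for k
    using private_moments(1)[OF that] .
  have sq: "integrable M (\<lambda>\<omega>. \<theta> t \<omega> * \<theta> t \<omega>)" "integrable M (\<lambda>\<omega>. \<eta> 0 t \<omega> * \<eta> 0 t \<omega>)"
     "\<And>k. k \<in> {1..K} \<Longrightarrow> integrable M (\<lambda>\<omega>. \<eta> k t \<omega> * \<eta> k t \<omega>)"
    using state_moments(3) public_moments(3) private_moments(3) by (simp_all add: power2_eq_square)
  note int = state_moments(2) public_moments(2) private_moments(2)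
  have prods: "integrable M (\<lambda>\<omega>. \<theta> t \<omega> * \<eta> 0 t \<omega>)" "\<And>k. k \<in> {1..K} \<Longrightarrow> integrable M (\<lambda>\<omega>. \<theta> t \<omega> * \<eta> k t \<omega>)"
      "\<And>k. k \<in> {1..K} \<Longrightarrow> integrable M (\<lambda>\<omega>. \<eta> 0 t \<omega> * \<eta> k t \<omega>)"
      "\<And>k j. k \<in> {1..K} \<Longrightarrow> j \<in> {1..K} \<Longrightarrow> j \<noteq> k \<Longrightarrow> integrable M (\<lambda>\<omega>. \<eta> k t \<omega> * \<eta> j t \<omega>)"
    by (auto intro!: indep_var_integrable state_noise_indep_var noise_indep_var int)
  have zero: "expectation (\<lambda>\<omega>. \<theta> t \<omega> * \<eta> 0 t \<omega>) = 0"
      "\<And>k. k \<in> {1..K} \<Longrightarrow> expectation (\<lambda>\<omega>. \<theta> t \<omega> * \<eta> k t \<omega>) = 0"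
      "\<And>k. k \<in> {1..K} \<Longrightarrow> expectation (\<lambda>\<omega>. \<eta> 0 t \<omega> * \<eta> k t \<omega>) = 0"
      "\<And>k j. k \<in> {1..K} \<Longrightarrow> j \<in> {1..K} \<Longrightarrow> j \<noteq> k \<Longrightarrow> expectation (\<lambda>\<omega>. \<eta> k t \<omega> * \<eta> j t \<omega>) = 0"
    by (subst indep_var_lebesgue_integral;
        auto intro!: state_noise_indep_var noise_indep_var int simp: state_moments(4) public_moments(4) private_moments(4))+
  have ev: "expectation (\<lambda>\<omega>. \<theta> t \<omega> * \<theta> t \<omega>) = 1 / \<tau>\<^sub>\<theta>" "expectation (\<lambda>\<omega>. \<eta> 0 t \<omega> * \<eta> 0 t \<omega>) = 1 / \<tau>\<^sub>g"
      "\<And>k. k \<in> {1..K} \<Longrightarrow> expectation (\<lambda>\<omega>. \<eta> k t \<omega> * \<eta> k t \<omega>) = 1 / \<tau>\<^sub>y"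
    using state_moments(5) public_moments(5) private_moments(5) by (simp_all add: power2_eq_square)
  show "linear_estimate t k \<in> borel_measurable M"
    using k unfolding lin[abs_def] by measurable
  show "integrable M (linear_estimate t k)" "expectation (linear_estimate t k) = 0"
    using k unfolding lin[abs_def] by (simp_all add: int state_moments(4) public_moments(4) private_moments(4))
  have expand: "linear_estimate t k \<omega> * linear_estimate t j \<omega> =
      a\<^sup>2 * (\<theta> t \<omega> * \<theta> t \<omega>) + 2 * a * b * (\<theta> t \<omega> * \<eta> 0 t \<omega>) + a * e * (\<theta> t \<omega> * \<eta> k t \<omega>) +
      a * e * (\<theta> t \<omega> * \<eta> j t \<omega>) + b\<^sup>2 * (\<eta> 0 t \<omega> * \<eta> 0 t \<omega>) + b * e * (\<eta> 0 t \<omega> * \<eta> k t \<omega>) +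
      b * e * (\<eta> 0 t \<omega> * \<eta> j t \<omega>) + e\<^sup>2 * (\<eta> k t \<omega> * \<eta> j t \<omega>)" for j k \<omega>
    by (simp add: lin algebra_simps power2_eq_square)
  show "integrable M (\<lambda>\<omega>. (linear_estimate t k \<omega>)\<^sup>2)"
    using k unfolding power2_eq_square expand by (simp add: sq prods)
  have "linear_estimate t k \<omega> * \<theta> t \<omega> =
      a * (\<theta> t \<omega> * \<theta> t \<omega>) + b * (\<theta> t \<omega> * \<eta> 0 t \<omega>) + e * (\<theta> t \<omega> * \<eta> k t \<omega>)" for \<omega>
    by (simp add: lin algebra_simps)
  then show "expectation (\<lambda>\<omega>. linear_estimate t k \<omega> * \<theta> t \<omega>) = signal_variance"
    using k by (simp add: sq prods zero ev) (simp add: a_def signal_variance_def T_def)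
  have V: "a\<^sup>2 / \<tau>\<^sub>\<theta> + b\<^sup>2 / \<tau>\<^sub>g + e\<^sup>2 / \<tau>\<^sub>y = signal_variance"
    and R: "a\<^sup>2 / \<tau>\<^sub>\<theta> + b\<^sup>2 / \<tau>\<^sub>g = signal_correlation * signal_variance"
    using variance_decomposition by (simp_all add: a_def b_def e_def T_def)
  show "expectation (\<lambda>\<omega>. linear_estimate t k \<omega> * linear_estimate t j \<omega>) =
      (if j = k then 1 else signal_correlation) * signal_variance" if j: "j \<in> {1..K}"
    \<comment> \<open>The product of the private noises has mean \<open>1 / \<tau>\<^sub>y\<close>
      for \<open>j = k\<close> and 0 otherwise; this one term separates \<open>V\<close> from
      \<open>R\<close>.\<close>
    using k j V R unfolding expand by (cases "j = k") (simp_all add: sq prods zero ev)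
qed

lemma posterior_mean_eq_linear_estimate:
  assumes k: "k \<in> {1..K}"
  shows "AE \<omega> in M. posterior_mean M \<theta> \<eta> t k \<omega> = linear_estimate t k \<omega>"
proof -
  let ?l = "\<lambda>(y, z). (\<tau>\<^sub>g * y + \<tau>\<^sub>y * z) / (\<tau>\<^sub>\<theta> + \<tau>\<^sub>g + \<tau>\<^sub>y)"
  let ?Y = "\<lambda>\<omega>. (public_signal \<theta> \<eta> t \<omega>, private_signal \<theta> \<eta> t k \<omega>)"
  note [measurable] = state_moments(1) public_moments(1) private_moments(1)[OF k]
  have l: "?l \<in> borel_measurable borel"
    by (subst borel_prod[symmetric]) measurable
  \<comment> \<open>The state must be independent of the two noises jointly, so they form one block
    of the independent family.\<close>
  have joint: "distr M lborel (\<theta> t) \<Otimes>\<^sub>M distr M lborel (\<lambda>\<omega>. (\<eta> 0 t \<omega>, \<eta> k t \<omega>)) =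
        distr M (lborel \<Otimes>\<^sub>M lborel) (\<lambda>\<omega>. (\<theta> t \<omega>, \<eta> 0 t \<omega>, \<eta> k t \<omega>))"
  proof -
    let ?J = "{Some 0, Some k}"
    have "(\<lambda>f. (f (Some 0), f (Some k))) \<in> PiM ?J (\<lambda>_. borel) \<rightarrow>\<^sub>M (lborel :: (real \<times> real) measure)"
      unfolding measurable_lborel1 borel_prod[symmetric] by measurable
    from indep_vars_imp_pair_distr[OF signals_indep[of t], of "{None}" ?J "\<lambda>f. f None" lborel, OF _ _ _ _ this]
    show ?thesis using k by simp
  qed
  have "AE \<omega> in M. cond_exp_given M ?Y (\<theta> t) \<omega> = ?l (?Y \<omega>)"
  proof (rule cond_exp_given_charact[OF _ state_moments(2) l])
    show "?Y \<in> M \<rightarrow>\<^sub>M borel"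
      unfolding borel_prod[symmetric] public_signal_def private_signal_def by measurable
    show "integrable M (\<lambda>\<omega>. ?l (?Y \<omega>))"
      using linear_estimate_moments(2)[OF k, of t] by (simp add: linear_estimate_def[abs_def])
    show "(\<integral>\<omega>. indicator B (?Y \<omega>) * \<theta> t \<omega> \<partial>M) = (\<integral>\<omega>. indicator B (?Y \<omega>) * ?l (?Y \<omega>) \<partial>M)"
      if "B \<in> sets borel" for B
      using expectation_posterior_normal2[OF precisions_pos state_normal public_noise private_noise[OF k] joint _
          state_moments(2) public_moments(2) private_moments(2)[OF k] that] k
        noise_indep_var[of 0 k t]
      by (simp add: public_signal_def private_signal_def)
  qed
  then show ?thesis
    by (simp add: posterior_mean_def linear_estimate_def)
qed

lemma posterior_moments:
  assumes k: "k \<in> {1..K}"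
  shows "integrable M (posterior_mean M \<theta> \<eta> t k)"
    "integrable M (\<lambda>\<omega>. (posterior_mean M \<theta> \<eta> t k \<omega>)\<^sup>2)"
    "expectation (posterior_mean M \<theta> \<eta> t k) = 0"
    "expectation (\<lambda>\<omega>. posterior_mean M \<theta> \<eta> t k \<omega> * \<theta> t \<omega>) = signal_variance"
    "j \<in> {1..K} \<Longrightarrow> expectation (\<lambda>\<omega>. posterior_mean M \<theta> \<eta> t k \<omega> * posterior_mean M \<theta> \<eta> t j \<omega>) =
      (if j = k then 1 else signal_correlation) * signal_variance"
proof -
  note lin = linear_estimate_moments[OF k, where t=t] and eq = posterior_mean_eq_linear_estimate[OF k, of t]
  note [measurable] = state_moments(1) lin(1)
  show "integrable M (posterior_mean M \<theta> \<eta> t k)"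
    by (rule integrable_cong_AE_imp[OF lin(2)]) (use eq in auto)
  show "integrable M (\<lambda>\<omega>. (posterior_mean M \<theta> \<eta> t k \<omega>)\<^sup>2)"
    by (rule integrable_cong_AE_imp[OF lin(3)]) (use eq in auto)
  show "expectation (posterior_mean M \<theta> \<eta> t k) = 0"
    unfolding lin(4)[symmetric] by (rule integral_cong_AE) (use eq in auto)
  show "expectation (\<lambda>\<omega>. posterior_mean M \<theta> \<eta> t k \<omega> * \<theta> t \<omega>) = signal_variance"
    unfolding lin(5)[symmetric] by (rule integral_cong_AE) (use eq in auto)
  assume j: "j \<in> {1..K}"
  note eqj = posterior_mean_eq_linear_estimate[OF j, of t] and [measurable] = linear_estimate_moments(1)[OF j, of t]
  show "expectation (\<lambda>\<omega>. posterior_mean M \<theta> \<eta> t k \<omega> * posterior_mean M \<theta> \<eta> t j \<omega>) =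
      (if j = k then 1 else signal_correlation) * signal_variance"
    unfolding lin(6)[OF j, symmetric] by (rule integral_cong_AE) (use eq eqj in auto)
qed

text \<open>Split both estimates as \<open>U + Z\<^sub>k\<close> and \<open>U + Z\<^sub>j\<close> with a common part \<open>U\<close>: the noise \<open>Z\<^sub>j\<close> is independent of
  \<open>U + Z\<^sub>k\<close>, and \<open>U\<close> is filtered from \<open>U + Z\<^sub>k\<close> like a state from a single noisy signal.\<close>

lemma expectation_other_posterior:
  assumes k: "k \<in> {1..K}" and j: "j \<in> {1..K}" and B[measurable]: "B \<in> sets borel"
  shows "(\<integral>\<omega>. indicator B (posterior_mean M \<theta> \<eta> t k \<omega>) * posterior_mean M \<theta> \<eta> t j \<omega> \<partial>M) =
    (if j = k then 1 else signal_correlation) *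
      (\<integral>\<omega>. indicator B (posterior_mean M \<theta> \<eta> t k \<omega>) * posterior_mean M \<theta> \<eta> t k \<omega> \<partial>M)"
proof (cases "j = k")
  case False
  define T where "T = \<tau>\<^sub>\<theta> + \<tau>\<^sub>g + \<tau>\<^sub>y"
  have T: "T > 0" using precisions_pos by (simp add: T_def)
  define a b e where "a = (\<tau>\<^sub>g + \<tau>\<^sub>y) / T" and "b = \<tau>\<^sub>g / T" and "e = \<tau>\<^sub>y / T"
  have abe: "a > 0" "b > 0" "e > 0" using T precisions_pos by (simp_all add: a_def b_def e_def)
  define U where "U = (\<lambda>\<omega>. a * \<theta> t \<omega> + b * \<eta> 0 t \<omega>)"
  define Z where "Z = (\<lambda>k \<omega>. e * \<eta> k t \<omega>)"
  have lin: "linear_estimate t k \<omega> = U \<omega> + Z k \<omega>" for k \<omega>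
    by (simp add: linear_estimate_eq U_def Z_def a_def b_def e_def T_def)
  note [measurable] = state_moments(1) public_moments(1) private_moments(1)[OF k] private_moments(1)[OF j]
  have [measurable]: "U \<in> borel_measurable M" "Z k \<in> borel_measurable M" "Z j \<in> borel_measurable M"
    unfolding U_def Z_def by measurable
  have int: "integrable M U" "integrable M (Z k)" "integrable M (Z j)"
    unfolding U_def Z_def using k j by (auto intro!: state_moments public_moments private_moments)
  \<comment> \<open>Variances of the common and of the private part; their reciprocals are the
    precisions in the filtering formula.\<close>
  define u where "u = a\<^sup>2 / \<tau>\<^sub>\<theta> + b\<^sup>2 / \<tau>\<^sub>g"
  define z where "z = e\<^sup>2 / \<tau>\<^sub>y"
  have uz: "u > 0" "z > 0" using abe precisions_pos by (simp_all add: u_def z_def add_pos_pos)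
  \<comment> \<open>The trivial \<open>0 +\<close> and the factor \<open>\<bar>a\<bar>\<close> match
    the shape in which affine images of normal variables are described.\<close>
  have "distributed M lborel (\<lambda>\<omega>. 0 + a * \<theta> t \<omega>) (normal_density (0 + a * 0) (\<bar>a\<bar> * (1 / sqrt \<tau>\<^sub>\<theta>)))"
    using abe precisions_pos by (intro normal_density_affine state_normal) auto
  moreover have "distributed M lborel (\<lambda>\<omega>. 0 + b * \<eta> 0 t \<omega>) (normal_density (0 + b * 0) (\<bar>b\<bar> * (1 / sqrt \<tau>\<^sub>g)))"
    using abe precisions_pos by (intro normal_density_affine public_noise) auto
  moreover have "indep_var borel (\<lambda>\<omega>. 0 + a * \<theta> t \<omega>) borel (\<lambda>\<omega>. 0 + b * \<eta> 0 t \<omega>)"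
    using indep_var_compose[OF state_noise_indep_var[of 0 t], of "\<lambda>x. 0 + a * x" borel "\<lambda>x. 0 + b * x" borel]
    by (simp add: comp_def)
  ultimately have "distributed M lborel (\<lambda>\<omega>. (0 + a * \<theta> t \<omega>) + (0 + b * \<eta> 0 t \<omega>))
     (normal_density ((0 + a * 0) + (0 + b * 0)) (sqrt ((\<bar>a\<bar> * (1 / sqrt \<tau>\<^sub>\<theta>))\<^sup>2 + (\<bar>b\<bar> * (1 / sqrt \<tau>\<^sub>g))\<^sup>2)))"
    using abe precisions_pos by (intro add_indep_normal) auto
  moreover have "sqrt ((\<bar>a\<bar> * (1 / sqrt \<tau>\<^sub>\<theta>))\<^sup>2 + (\<bar>b\<bar> * (1 / sqrt \<tau>\<^sub>g))\<^sup>2) = 1 / sqrt (1 / u)"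
    using precisions_pos by (simp add: u_def power_mult_distrib power_divide real_sqrt_divide)
  ultimately have U: "distributed M lborel U (normal_density 0 (1 / sqrt (1 / u)))"
    by (simp add: U_def)
  have "distributed M lborel (\<lambda>\<omega>. 0 + e * \<eta> k t \<omega>) (normal_density (0 + e * 0) (\<bar>e\<bar> * (1 / sqrt \<tau>\<^sub>y)))"
    using abe precisions_pos k by (intro normal_density_affine private_noise) auto
  moreover have "\<bar>e\<bar> * (1 / sqrt \<tau>\<^sub>y) = 1 / sqrt (1 / z)"
    using precisions_pos abe by (simp add: z_def real_sqrt_divide)
  ultimately have Zk: "distributed M lborel (Z k) (normal_density 0 (1 / sqrt (1 / z)))"
    by (simp add: Z_def)
  have indUZ: "indep_var borel U borel (Z k)"
    using indep_vars_imp_indep_var[OF signals_indep[of t], of "{None, Some 0}" "{Some k}"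
        "\<lambda>f. a * f None + b * f (Some 0)" borel "\<lambda>f. e * f (Some k)" borel] k
    by (simp add: U_def Z_def)
  have V: "u + z = signal_variance" and R: "u = signal_correlation * signal_variance"
    using variance_decomposition by (simp_all add: u_def z_def a_def b_def e_def T_def)
  \<comment> \<open>Common variance over total variance: the regression coefficient between equally
    dispersed variables, that is, their correlation.\<close>
  have "(1 / z) / (1 / u + 1 / z) = u / (u + z)"
    using uz by (simp add: field_simps)
  also have "\<dots> = signal_correlation"
    using signal_variance_pos R V by simp
  finally have ratio: "(1 / z) / (1 / u + 1 / z) = signal_correlation" .
  let ?W = "\<lambda>\<omega>. indicator B (U \<omega> + Z k \<omega>) :: real"
  have 1: "(\<integral>\<omega>. ?W \<omega> * U \<omega> \<partial>M) = signal_correlation * (\<integral>\<omega>. ?W \<omega> * (U \<omega> + Z k \<omega>) \<partial>M)"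
    using expectation_posterior_normal[OF _ _ U Zk indUZ int(1,2) B] uz
    by (simp add: ratio del: divide_divide_eq_left divide_divide_eq_right)
  \<comment> \<open>\<open>?W\<close> is a function of \<open>U\<close> and \<open>Z k\<close>,
    hence independent of the centred \<open>Z j\<close>, whose contribution vanishes.\<close>
  have "indep_var borel ?W borel (Z j)"
    using indep_vars_imp_indep_var[OF signals_indep[of t], of "{None, Some 0, Some k}" "{Some j}"
        "\<lambda>f. indicator B (a * f None + b * f (Some 0) + e * f (Some k))" borel "\<lambda>f. e * f (Some j)" borel] k j False
    by (simp add: U_def Z_def)
  moreover have "integrable M ?W"
    by (rule integrable_const_bound[of _ 1]) (auto split: split_indicator)
  ultimately have 2: "integrable M (\<lambda>\<omega>. ?W \<omega> * Z j \<omega>)" "(\<integral>\<omega>. ?W \<omega> * Z j \<omega> \<partial>M) = 0"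
    using indep_var_lebesgue_integral[of ?W "Z j"] indep_var_integrable[of ?W "Z j"] int private_moments(4)[OF j]
    by (auto simp: Z_def)
  have "integrable M (\<lambda>\<omega>. ?W \<omega> * U \<omega>)"
    by (rule Bochner_Integration.integrable_bound[OF int(1)]) (auto split: split_indicator)
  with 1 2 have "(\<integral>\<omega>. ?W \<omega> * (U \<omega> + Z j \<omega>) \<partial>M) = signal_correlation * (\<integral>\<omega>. ?W \<omega> * (U \<omega> + Z k \<omega>) \<partial>M)"
    by (simp add: distrib_left)
  moreover have "(\<integral>\<omega>. indicator B (posterior_mean M \<theta> \<eta> t k \<omega>) * posterior_mean M \<theta> \<eta> t i \<omega> \<partial>M) =
      (\<integral>\<omega>. ?W \<omega> * (U \<omega> + Z i \<omega>) \<partial>M)" if "i \<in> {j, k}" for i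
    using posterior_mean_eq_linear_estimate[OF k, of t] posterior_mean_eq_linear_estimate[of i t] that j k
    by (intro integral_cong_AE) (auto simp: lin)
  ultimately show ?thesis using False by simp
qed simp

end

subsection \<open>Convexity and concentration of shares\<close>

text \<open>The chord slope is a value of \<open>f'\<close> between x and y, which monotonicity
  compares with \<open>f' x\<close>.\<close>

lemma deriv_mono_imp_above_tangent:
  fixes f :: "real \<Rightarrow> real"
  assumes f: "\<And>x. x \<in> {l..u} \<Longrightarrow> (f has_real_derivative f' x) (at x)" and mono: "mono_on {l..u} f'"
    and xy: "x \<in> {l..u}" "y \<in> {l..u}"
  shows "f' x * (y - x) \<le> f y - f x"
proof (cases x y rule: linorder_cases)
  case less
  then obtain z where z: "x < z" "z < y" "f y - f x = (y - x) * f' z"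
    using MVT2[OF less, of f f'] f xy by force
  then have "f' x \<le> f' z" using xy by (intro mono_onD[OF mono]) auto
  then show ?thesis using z less by (simp add: mult.commute mult_left_mono)
next
  case greater
  then obtain z where z: "y < z" "z < x" "f x - f y = (x - y) * f' z"
    using MVT2[OF greater, of f f'] f xy by force
  then have "f' z \<le> f' x" using xy by (intro mono_onD[OF mono]) auto
  then have "(x - y) * f' z \<le> (x - y) * f' x" using greater by (intro mult_left_mono) auto
  then show ?thesis using z(3) by (simp add: algebra_simps)
qed simp

text \<open>One-sided Abel summation: each induction step lowers the coefficient of a nonnegative
  partial sum.\<close>

lemma summation_by_parts_ge:
  fixes c d :: "nat \<Rightarrow> real"
  assumes c: "\<And>i. Suc i < n \<Longrightarrow> c (Suc i) \<le> c i" and d: "\<And>j. j < n \<Longrightarrow> 0 \<le> (\<Sum>i<j. d i)"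
    and j: "j < n"
  shows "c j * (\<Sum>i<Suc j. d i) \<le> (\<Sum>i<Suc j. c i * d i)"
  using j
proof (induction j)
  case (Suc j)
  have "c (Suc j) * (\<Sum>i<Suc (Suc j). d i) = c (Suc j) * (\<Sum>i<Suc j. d i) + c (Suc j) * d (Suc j)"
    by (simp add: algebra_simps)
  also have "\<dots> \<le> c j * (\<Sum>i<Suc j. d i) + c (Suc j) * d (Suc j)"
    using c[of j] d[of "Suc j"] Suc.prems by (intro add_right_mono mult_right_mono) simp_all
  finally show ?case using Suc by simp
qed simp

lemma sum_largest_eq:
  "n \<le> K \<Longrightarrow> sum_largest K n x = (\<Sum>i<n. rev (sort (map x [1..<Suc K])) ! i)"
  by (simp add: sum_largest_def sum_list_sum_nth lessThan_atLeast0 del: upt_Suc)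

text \<open>A symmetric sum depends only on the multiset of entries, which sorting preserves. This
  links sums over providers to the sorted lists behind \<open>majorizes\<close>.\<close>

lemma sum_eq_sum_sorted:
  "(\<Sum>k=1..K. f (x k)) = (\<Sum>i<K. f (rev (sort (map x [1..<Suc K])) ! i))"
proof -
  have "(\<Sum>k=1..K. f (x k)) = sum_list (map (\<lambda>k. f (x k)) [1..<Suc K])"
    by (subst sum_list_distinct_conv_sum_set) (auto simp: atLeastLessThanSuc_atLeastAtMost simp del: upt_Suc)
  also have "\<dots> = sum_mset (image_mset f (mset (map x [1..<Suc K])))"
    by (simp flip: sum_mset_sum_list add: comp_def image_mset.compositionality del: upt_Suc)
  also have "mset (map x [1..<Suc K]) = mset (rev (sort (map x [1..<Suc K])))"
    by (simp del: upt_Suc)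
  also have "sum_mset (image_mset f \<dots>) = sum_list (map f (rev (sort (map x [1..<Suc K]))))"
    by (metis mset_map sum_mset_sum_list)
  also have "\<dots> = (\<Sum>i<K. f (rev (sort (map x [1..<Suc K])) ! i))"
    by (simp add: sum_list_sum_nth lessThan_atLeast0 del: upt_Suc)
  finally show ?thesis .
qed

text \<open>The tangents of \<^term>\<open>f\<close> at the sorted entries of \<^term>\<open>x\<close> have decreasing slopes, so summation by parts
  reduces the claim to the partial-sum inequalities of majorization.\<close>

lemma karamata_inequality:
  fixes f :: "real \<Rightarrow> real"
  assumes f: "\<And>z. z \<in> {l..u} \<Longrightarrow> (f has_real_derivative f' z) (at z)" and mono: "mono_on {l..u} f'"
    and x: "\<And>k. k \<in> {1..K} \<Longrightarrow> x k \<in> {l..u}" and x': "\<And>k. k \<in> {1..K} \<Longrightarrow> x' k \<in> {l..u}"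
    and maj: "majorizes K x' x"
  shows "(\<Sum>k=1..K. f (x k)) \<le> (\<Sum>k=1..K. f (x' k))"
proof (cases K)
  case (Suc m)
  define p where "p i = rev (sort (map x [1..<Suc K])) ! i" for i
  define q where "q i = rev (sort (map x' [1..<Suc K])) ! i" for i
  have "p i \<in> set (rev (sort (map x [1..<Suc K])))" "q i \<in> set (rev (sort (map x' [1..<Suc K])))"
    if "i < K" for i
    unfolding p_def q_def using that by (intro nth_mem; simp del: upt_Suc)+
  then have pq: "p i \<in> {l..u}" "q i \<in> {l..u}" if "i < K" for i
    using that x x' by (fastforce simp del: upt_Suc)+
  have anti: "p (Suc i) \<le> p i" if "Suc i < K" for i
  proof -
    have "sorted_wrt (\<ge>) (rev (sort (map x [1..<Suc K])))"
      unfolding sorted_wrt_rev by simp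
    then show ?thesis
      using that unfolding p_def by (intro sorted_wrt_nth_less[where P="(\<ge>)"]) (auto simp del: upt_Suc)
  qed
  have D: "0 \<le> (\<Sum>i<j. q i - p i)" if "j \<le> K" for j
    using maj that by (simp add: majorizes_def sum_largest_eq p_def q_def sum_subtractf)
  have D0: "(\<Sum>i<K. q i - p i) = 0"
    using maj by (simp add: majorizes_def sum_largest_eq p_def q_def sum_subtractf)
  \<comment> \<open>Equality of the totals makes the left side 0, whatever the sign of the smallest
    slope \<open>f' (p m)\<close>.\<close>
  have "f' (p m) * (\<Sum>i<Suc m. q i - p i) \<le> (\<Sum>i<Suc m. f' (p i) * (q i - p i))"
    using anti pq D Suc by (intro summation_by_parts_ge[where n=K] mono_onD[OF mono]) auto
  then have "0 \<le> (\<Sum>i<K. f' (p i) * (q i - p i))"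
    using D0 Suc by (simp only: mult_zero_right)
  also have "\<dots> \<le> (\<Sum>i<K. f (q i) - f (p i))"
    using pq by (intro sum_mono deriv_mono_imp_above_tangent[OF f mono]) auto
  finally show ?thesis
    unfolding sum_eq_sum_sorted by (simp add: p_def q_def sum_subtractf)
qed simp

text \<open>Derivatives are computed for an explicit \<open>F\<close> and carried over to
  \<open>f\<close> at interior points, near which the two agree. \<open>F'\<close> may vanish at the
  endpoints, where continuity takes over.\<close>

lemma strictly_increasing_insideI:
  assumes F: "\<And>z. z \<in> {l..u} \<Longrightarrow> (F has_real_derivative F' z) (at z)"
    and pos: "\<And>z. z \<in> {l<..<u} \<Longrightarrow> F' z > 0" and eq: "\<And>z. z \<in> {l..u} \<Longrightarrow> f z = F z"
  shows "strictly_increasing_inside l u f"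
  unfolding strictly_increasing_inside_def
proof (intro conjI ballI strict_mono_onI)
  fix a b assume ab: "a \<in> {l..u}" "b \<in> {l..u}" "a < b"
  have "F a < F b"
  proof (rule DERIV_pos_imp_increasing_open[OF ab(3)])
    show "\<exists>y. (F has_real_derivative y) (at z) \<and> 0 < y" if "a < z" "z < b" for z
      using F[of z] pos[of z] that ab by auto
    show "continuous_on {a..b} F"
    proof (rule DERIV_continuous_on)
      show "(F has_real_derivative F' z) (at z within {a..b})" if "z \<in> {a..b}" for z
        by (rule has_field_derivative_at_within[OF F]) (use that ab in auto)
    qed
  qed
  then show "f a < f b" using eq ab by simp
next
  fix z assume z: "z \<in> {l<..<u}"
  then have "(F has_real_derivative F' z) (at z)" by (intro F) auto
  then have "(f has_real_derivative F' z) (at z)"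
    by (rule has_field_derivative_transform_within_open[OF _ open_greaterThanLessThan z]) (auto simp: eq)
  then show "\<exists>D>0. (f has_real_derivative D) (at z)" using pos[OF z] by blast
qed

lemma share_vector_bounds:
  assumes "share_vector K x" "k \<in> {1..K}"
  shows "x k \<in> {0..1}"
  using assms member_le_sum[of k "{1..K}" x] by (auto simp: share_vector_def)

lemma sum_dominant_share:
  assumes "K \<ge> 1"
  shows "(\<Sum>k=1..K. f (dominant_share K z k)) = f z + (real K - 1) * f ((1 - z) / (real K - 1))"
proof -
  have "{1..K} = insert 1 {2..K}" using assms by auto
  moreover have "(\<Sum>k=2..K. f (dominant_share K z k)) = (real K - 1) * f ((1 - z) / (real K - 1))"
    using assms by (simp add: dominant_share_def of_nat_diff)
  ultimately show ?thesis by (simp add: dominant_share_def)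
qed

lemma share_vector_dominant_share:
  assumes "K \<ge> 2" "z \<in> {0..1}"
  shows "share_vector K (dominant_share K z)"
  using assms sum_dominant_share[of K "\<lambda>x. x" z] by (auto simp: share_vector_def dominant_share_def)

section \<open>Share weights, their convexity, and monotonicity in the shares\<close>

definition share_weight :: "real \<Rightarrow> real \<Rightarrow> real \<Rightarrow> real" where
  "share_weight b \<delta> z = z / (b - \<delta> * z)"

text \<open>The numerator of the quotient rule is (b - \<delta>z) + \<delta>z = b.\<close>

lemma share_weight_deriv:
  assumes "b - \<delta> * z \<noteq> 0"
  shows "(share_weight b \<delta> has_real_derivative b / (b - \<delta> * z)\<^sup>2) (at z)"
  unfolding share_weight_def[abs_def] using assms
  by (auto intro!: derivative_eq_intros simp: power2_eq_square)

lemma share_weight_sq_deriv: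
  assumes "b - \<delta> * z \<noteq> 0"
  shows "((\<lambda>z. (share_weight b \<delta> z)\<^sup>2) has_real_derivative 2 * b * z / (b - \<delta> * z) ^ 3) (at z)"
  by (rule derivative_eq_intros refl share_weight_deriv[OF assms])+
     (use assms in \<open>simp add: share_weight_def power2_eq_square power3_eq_cube\<close>)

text \<open>The parameters stand for \<open>b = 2\<beta>\<close>, \<open>\<delta> = d(1 - \<rho>)\<close> and \<open>r = d\<rho>\<close>. Below, \<open>weight_sum\<close> is the
  paper's \<open>\<Lambda>(x)\<close>; in equilibrium \<open>\<gamma>\<^sub>k\<close> is \<open>gain \<Lambda>\<close> divided by \<open>b - \<delta> x\<^sub>k\<close>, so that \<open>S = \<Lambda> gain \<Lambda>\<close> and
  \<open>dispersion\<close> is \<open>\<rho> S\<^sup>2 + (1 - \<rho>) Q\<close>.\<close>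

locale concentration =
  fixes b \<delta> r \<xi> \<rho> :: real
  assumes params: "0 < \<delta>" "0 < r" "\<delta> + r < b" "0 < \<xi>" "0 < \<rho>" "\<rho> < 1"
begin

abbreviation "w \<equiv> share_weight b \<delta>"

definition weight_sum :: "nat \<Rightarrow> (nat \<Rightarrow> real) \<Rightarrow> real" where
  "weight_sum K x = (\<Sum>k=1..K. w (x k))"

definition square_sum :: "nat \<Rightarrow> (nat \<Rightarrow> real) \<Rightarrow> real" where
  "square_sum K x = (\<Sum>k=1..K. (w (x k))\<^sup>2)"

definition gain :: "real \<Rightarrow> real" where
  "gain L = \<xi> / (1 - r * L)"

definition dispersion :: "real \<Rightarrow> real \<Rightarrow> real" where
  "dispersion L P = \<rho> * (L * gain L)\<^sup>2 + (1 - \<rho>) * ((gain L)\<^sup>2 * P)"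

lemma denominator_pos:
  assumes "z \<le> 1"
  shows "0 < b - \<delta> * z"
proof -
  have "\<delta> * z \<le> \<delta> * 1" using assms params by (intro mult_left_mono) auto
  then show ?thesis using params by linarith
qed

text \<open>Denominators shrink as the share grows. In the second derivative this gives only a weak
  inequality at y = 0, where the numerator vanishes; strictness comes from the numerator.\<close>

lemma weight_derivs_strict_mono:
  "strict_mono_on {0..1} (\<lambda>z. b / (b - \<delta> * z)\<^sup>2)"
  "strict_mono_on {0..1} (\<lambda>z. 2 * b * z / (b - \<delta> * z) ^ 3)"
proof (safe intro!: strict_mono_onI)
  fix y z :: real assume yz: "y \<in> {0..1}" "z \<in> {0..1}" "y < z"
  have d: "0 < b - \<delta> * z" "b - \<delta> * z < b - \<delta> * y" and b: "b > 0"
    using denominator_pos yz params by auto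
  show "b / (b - \<delta> * y)\<^sup>2 < b / (b - \<delta> * z)\<^sup>2"
    using d b by (intro divide_strict_left_mono power_strict_mono mult_pos_pos) auto
  have "2 * b * y / (b - \<delta> * y) ^ 3 \<le> 2 * b * y / (b - \<delta> * z) ^ 3"
    using d b yz by (intro divide_left_mono power_mono mult_pos_pos zero_less_power) auto
  also have "\<dots> < 2 * b * z / (b - \<delta> * z) ^ 3"
    using d b yz by (intro divide_strict_right_mono) auto
  finally show "2 * b * y / (b - \<delta> * y) ^ 3 < 2 * b * z / (b - \<delta> * z) ^ 3" .
qed

text \<open>Every denominator is at least b - \<delta>, so shares summing to 1 give at most 1 / (b -
  \<delta>), while r < b - \<delta>. The second bound keeps the feedback among clients below 1, so
  that \<open>gain\<close> is finite and positive.\<close>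

lemma weight_sum_bounds:
  assumes x: "share_vector K x"
  shows "0 \<le> weight_sum K x" "r * weight_sum K x < 1"
proof -
  have xk: "x k \<in> {0..1}" if "k \<in> {1..K}" for k using share_vector_bounds[OF x that] .
  show "0 \<le> weight_sum K x"
    unfolding weight_sum_def share_weight_def using xk denominator_pos
    by (intro sum_nonneg divide_nonneg_nonneg) (auto intro: less_imp_le)
  have "weight_sum K x \<le> (\<Sum>k=1..K. x k / (b - \<delta>))"
    unfolding weight_sum_def share_weight_def
  proof (intro sum_mono divide_left_mono mult_pos_pos)
    fix k assume k: "k \<in> {1..K}"
    show "b - \<delta> \<le> b - \<delta> * x k" using xk[OF k] params by auto
    show "0 < b - \<delta> * x k" "0 \<le> x k" "0 < b - \<delta>" using xk[OF k] denominator_pos params by auto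
  qed
  also have "\<dots> = 1 / (b - \<delta>)"
    using x by (simp add: share_vector_def flip: sum_divide_distrib)
  finally have "r * weight_sum K x \<le> r * (1 / (b - \<delta>))"
    using params by (intro mult_left_mono) auto
  also have "\<dots> < 1" using params by simp
  finally show "r * weight_sum K x < 1" .
qed

lemma square_sum_nonneg: "0 \<le> square_sum K x"
  unfolding square_sum_def by (intro sum_nonneg) simp

lemma weight_deriv:
  assumes "z \<in> {0..1}"
  shows "(w has_real_derivative b / (b - \<delta> * z)\<^sup>2) (at z)"
    "((\<lambda>z. (w z)\<^sup>2) has_real_derivative 2 * b * z / (b - \<delta> * z) ^ 3) (at z)"
  using denominator_pos[of z] assms by (intro share_weight_deriv share_weight_sq_deriv; simp)+

lemma weight_sum_mono:
  assumes x: "share_vector K x" and x': "share_vector K x'" and maj: "majorizes K x' x"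
  shows "weight_sum K x \<le> weight_sum K x'"
  unfolding weight_sum_def
  by (rule karamata_inequality[OF weight_deriv(1) strict_mono_on_imp_mono_on[OF weight_derivs_strict_mono(1)]
        share_vector_bounds[OF x] share_vector_bounds[OF x'] maj])

lemma square_sum_mono:
  assumes x: "share_vector K x" and x': "share_vector K x'" and maj: "majorizes K x' x"
  shows "square_sum K x \<le> square_sum K x'"
  unfolding square_sum_def
  by (rule karamata_inequality[OF weight_deriv(2) strict_mono_on_imp_mono_on[OF weight_derivs_strict_mono(2)]
        share_vector_bounds[OF x] share_vector_bounds[OF x'] maj])

lemma gain_pos: "r * L < 1 \<Longrightarrow> 0 < gain L"
  using params by (simp add: gain_def)

lemma gain_mono:
  assumes "L \<le> L'" "r * L' < 1"
  shows "gain L \<le> gain L'"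
proof -
  have "r * L \<le> r * L'" using assms params by (intro mult_left_mono) auto
  then have "1 - r * L' \<le> 1 - r * L" "0 < 1 - r * L'" "0 < 1 - r * L" using assms by linarith+
  then show ?thesis
    using params unfolding gain_def by (intro divide_left_mono mult_pos_pos) auto
qed

lemma aggregate_gain_mono:
  assumes "0 \<le> L" "L \<le> L'" "r * L' < 1"
  shows "L * gain L \<le> L' * gain L'"
proof -
  have "r * L \<le> r * L'" using assms params by auto
  then show ?thesis
    using assms gain_pos[of L] by (intro mult_mono gain_mono) auto
qed

lemma dispersion_mono:
  assumes "0 \<le> L" "L \<le> L'" "r * L' < 1" "0 \<le> P" "P \<le> P'"
  shows "dispersion L P \<le> dispersion L' P'"
proof -
  have "r * L \<le> r * L'" using assms params by auto
  then have "0 \<le> gain L" using gain_pos[of L] assms by auto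
  then show ?thesis
    unfolding dispersion_def using assms params
    by (intro add_mono mult_left_mono mult_mono power_mono aggregate_gain_mono gain_mono) auto
qed

lemma gain_deriv:
  assumes "r * L < 1"
  shows "(gain has_real_derivative \<xi> * r / (1 - r * L)\<^sup>2) (at L)"
  unfolding gain_def[abs_def] using assms
  by (auto intro!: derivative_eq_intros simp: power2_eq_square)

section \<open>Derivatives along the dominant-provider family\<close>

text \<open>Each of the K - 1 rivals loses share at rate 1 / (K - 1), so the two factors cancel.
  Above the uniform share 1/K the dominant provider is strictly larger than every rival, which gives
  the sign.\<close>

lemma dominant_deriv:
  assumes K: "K \<ge> 2" and f: "\<And>z. z \<in> {0..1} \<Longrightarrow> (f has_real_derivative f' z) (at z)" and z: "z \<in> {1 / K..1}"
  shows "((\<lambda>z. \<Sum>k=1..K. f (dominant_share K z k)) has_real_derivative f' z - f' ((1 - z) / (real K - 1))) (at z)"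
    and "strict_mono_on {0..1} f' \<Longrightarrow> 1 / K < z \<Longrightarrow> 0 < f' z - f' ((1 - z) / (real K - 1))"
proof -
  have K1: "real K - 1 > 0" "real K > 0" using K by auto
  have z0: "0 < z" "z \<le> 1" using z K1 by (auto intro: less_le_trans[of 0 "1 / real K"])
  have y: "(1 - z) / (real K - 1) \<in> {0..1}"
  proof -
    have "1 \<le> real K * z" using z K1 by (simp add: field_simps)
    moreover have "real K * z \<le> real K" "2 \<le> real K" using z0 K K1 by auto
    ultimately show ?thesis using K1 z0 by (simp add: field_simps)
  qed
  have "((\<lambda>z. f z + (real K - 1) * f ((1 - z) / (real K - 1))) has_real_derivative
      f' z + (real K - 1) * (f' ((1 - z) / (real K - 1)) * (- 1 / (real K - 1)))) (at z)"
  proof (intro DERIV_add DERIV_cmult)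
    show "(f has_real_derivative f' z) (at z)" using z0 by (intro f) auto
    have "((\<lambda>z. (1 - z) / (real K - 1)) has_real_derivative - 1 / (real K - 1)) (at z)"
      by (rule DERIV_cdivide) (auto intro!: derivative_eq_intros)
    from DERIV_chain2[OF f[OF y] this]
    show "((\<lambda>z. f ((1 - z) / (real K - 1))) has_real_derivative
      f' ((1 - z) / (real K - 1)) * (- 1 / (real K - 1))) (at z)" .
  qed
  moreover have "(real K - 1) * (f' ((1 - z) / (real K - 1)) * (- 1 / (real K - 1))) = - f' ((1 - z) / (real K - 1))"
    using K1 by simp
  ultimately show "((\<lambda>z. \<Sum>k=1..K. f (dominant_share K z k)) has_real_derivative f' z - f' ((1 - z) / (real K - 1))) (at z)"
    using K by (subst sum_dominant_share) simp_all
  assume "strict_mono_on {0..1} f'" "1 / K < z"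
  moreover from this have "(1 - z) / (real K - 1) < z"
    using K1 by (simp add: field_simps)
  ultimately show "0 < f' z - f' ((1 - z) / (real K - 1))"
    using y z0 strict_mono_onD[of "{0..1}" f' "(1 - z) / (real K - 1)" z] by auto
qed

text \<open>One objective with weights \<open>A\<close> and \<open>B\<close> covers both loss terms
  and their sum, so the derivative is computed once.\<close>

lemma dominant_objective_increasing:
  assumes K: "K \<ge> 2" and AB: "0 \<le> A" "0 \<le> B" "0 < A \<or> 0 < B"
    and f: "\<And>x. share_vector K x \<Longrightarrow> f x = C + A * (weight_sum K x * gain (weight_sum K x)) +
      B * dispersion (weight_sum K x) (square_sum K x)"
  shows "strictly_increasing_inside (1 / K) 1 (\<lambda>z. f (dominant_share K z))"
proof -
  define L where "L z = weight_sum K (dominant_share K z)" for z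
  define P where "P z = square_sum K (dominant_share K z)" for z
  define y where "y z = (1 - z) / (real K - 1)" for z
  define L' where "L' z = b / (b - \<delta> * z)\<^sup>2 - b / (b - \<delta> * y z)\<^sup>2" for z
  define P' where "P' z = 2 * b * z / (b - \<delta> * z) ^ 3 - 2 * b * y z / (b - \<delta> * y z) ^ 3" for z
  define g' where "g' z = \<xi> * r / (1 - r * L z)\<^sup>2 * L' z" for z
  let ?g = "\<lambda>z. gain (L z)"
  \<comment> \<open>The objective with \<open>dispersion\<close> unfolded, as a function of every
    real z; it agrees with \<open>f\<close> wherever the dominant shares form a share
    vector.\<close>
  let ?F = "\<lambda>z. C + A * (L z * ?g z) + B * (\<rho> * (L z * ?g z)\<^sup>2 + (1 - \<rho>) * ((?g z)\<^sup>2 * P z))"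
  let ?F' = "\<lambda>z. A * (L' z * ?g z + L z * g' z) + B * (\<rho> * (2 * (L z * ?g z) * (L' z * ?g z + L z * g' z)) +
    (1 - \<rho>) * (2 * ?g z * g' z * P z + (?g z)\<^sup>2 * P' z))"
  have sub: "z \<in> {0..1}" "0 < z" if "z \<in> {1 / K..1}" for z
    using that K by (auto intro: less_le_trans[of 0 "1 / real K"] order_trans[of 0 "1 / real K"])
  have sv: "share_vector K (dominant_share K z)" if "z \<in> {1 / K..1}" for z
    using sub[OF that] K by (intro share_vector_dominant_share)
  have dL: "(L has_real_derivative L' z) (at z)" if "z \<in> {1 / K..1}" for z
    unfolding L_def[abs_def] L'_def y_def weight_sum_def
    by (rule dominant_deriv(1)[OF K weight_deriv(1) that])
  have dP: "(P has_real_derivative P' z) (at z)" if "z \<in> {1 / K..1}" for z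
    unfolding P_def[abs_def] P'_def y_def square_sum_def
    by (rule dominant_deriv(1)[OF K weight_deriv(2) that])
  have Lr: "0 \<le> L z" "r * L z < 1" if "z \<in> {1 / K..1}" for z
    using weight_sum_bounds[OF sv[OF that]] by (simp_all add: L_def)
  have dg: "(?g has_real_derivative g' z) (at z)" if "z \<in> {1 / K..1}" for z
    unfolding g'_def by (rule DERIV_chain2[OF gain_deriv[OF Lr(2)[OF that]] dL[OF that]])
  show ?thesis
  proof (rule strictly_increasing_insideI[where F="?F" and F'="?F'"])
    fix z :: real assume z: "z \<in> {1 / K..1}"
    note d = dL[OF z] dP[OF z] dg[OF z]
    show "(?F has_real_derivative ?F' z) (at z)"
      by (rule derivative_eq_intros refl d)+ (simp add: algebra_simps power2_eq_square)
    show "f (dominant_share K z) = ?F z"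
      using f[OF sv[OF z]] by (simp add: L_def P_def dispersion_def)
  next
    fix z :: real assume z: "z \<in> {1 / K<..<1}"
    then have zc: "z \<in> {1 / K..1}" "1 / K < z" by auto
    have L': "L' z > 0"
      unfolding L'_def y_def
      by (rule dominant_deriv(2)[OF K weight_deriv(1) zc(1) weight_derivs_strict_mono(1) zc(2)])
    have P': "P' z > 0"
      unfolding P'_def y_def
      by (rule dominant_deriv(2)[OF K weight_deriv(2) zc(1) weight_derivs_strict_mono(2) zc(2)])
    have g: "?g z > 0" using gain_pos Lr(2)[OF zc(1)] .
    have g': "g' z > 0" unfolding g'_def using params Lr(2)[OF zc(1)] L' by (intro mult_pos_pos divide_pos_pos) auto
    have "0 < w z"
      using sub[OF zc(1)] denominator_pos by (simp add: share_weight_def)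
    moreover have "0 \<le> (real K - 1) * w (y z)"
    proof -
      have "y z \<le> 1" "0 \<le> y z"
        using share_vector_bounds[OF sv[OF zc(1)], of 2] K by (simp_all add: dominant_share_def y_def)
      then show ?thesis using denominator_pos[of "y z"] K by (simp add: share_weight_def)
    qed
    \<comment> \<open>The dominant provider has positive weight and the rivals have nonnegative
      weight.\<close>
    ultimately have L: "L z > 0"
      using sum_dominant_share[of K w z] K by (simp add: L_def weight_sum_def y_def)
    have P: "P z \<ge> 0" by (simp add: P_def square_sum_nonneg)
    have 1: "0 < L' z * ?g z + L z * g' z"
      using L L' g g' by (intro add_pos_pos mult_pos_pos)
    have 2: "0 < \<rho> * (2 * (L z * ?g z) * (L' z * ?g z + L z * g' z)) +
        (1 - \<rho>) * (2 * ?g z * g' z * P z + (?g z)\<^sup>2 * P' z)"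
      using 1 L L' g g' P P' params
      by (intro add_pos_nonneg mult_pos_pos mult_nonneg_nonneg add_nonneg_nonneg) auto
    show "?F' z > 0"
      using AB mult_nonneg_nonneg[OF AB(1) less_imp_le[OF 1]] mult_nonneg_nonneg[OF AB(2) less_imp_le[OF 2]]
        mult_pos_pos[OF _ 1, of A] mult_pos_pos[OF _ 2, of B] by linarith
  qed
qed

end

subsection \<open>Equilibrium\<close>

text \<open>Comparison with the vertex of the parabola suffices: the payoff lost by choosing a
  instead of the vertex b is \<beta>(a - b)^2.\<close>

lemma quadratic_optimum:
  fixes \<beta> :: real
  assumes "\<beta> > 0" and opt: "\<And>b. (b - c) * (p - \<beta> * b) \<le> (a - c) * (p - \<beta> * a)"
  shows "2 * \<beta> * a = p + \<beta> * c"
proof -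
  define b where "b = (p + \<beta> * c) / (2 * \<beta>)"
  have p: "p = 2 * \<beta> * b - \<beta> * c" using \<open>\<beta> > 0\<close> by (simp add: b_def)
  have "\<beta> * (a - b)\<^sup>2 = (b - c) * (p - \<beta> * b) - (a - c) * (p - \<beta> * a)"
    unfolding p by algebra
  then have "\<beta> * (a - b)\<^sup>2 \<le> 0" using opt[of b] by simp
  then have "(a - b)\<^sup>2 \<le> 0" using \<open>\<beta> > 0\<close> by (simp add: mult_le_0_iff)
  then have "a = b" by simp
  then show ?thesis using p by simp
qed

context scarcity_signals
begin

abbreviation posterior :: "'t \<Rightarrow> nat \<Rightarrow> 'a \<Rightarrow> real" where
  "posterior \<equiv> posterior_mean M \<theta> \<eta>"

text \<open>Conditioning on m_k replaces every other m_j by \<rho> m_k and leaves m_k itself alone.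
  The own term exceeds this common pattern by the factor 1 - \<rho>, the origin of d(1 - \<rho>)x_k
  in the equilibrium denominators.\<close>

lemma cond_exp_aggregate_action:
  assumes k: "k \<in> {1..K}"
  shows "AE \<omega> in M. cond_exp_given M (posterior t k) (aggregate_action K x (affine_action \<alpha> \<gamma> (posterior t))) \<omega> =
    (\<Sum>j=1..K. x j * \<alpha> j) + (signal_correlation * (\<Sum>j=1..K. x j * \<gamma> j) + (1 - signal_correlation) * (x k * \<gamma> k)) *
      posterior t k \<omega>"
proof (rule cond_exp_given_charact[where l="\<lambda>\<mu>. (\<Sum>j=1..K. x j * \<alpha> j) +
    (signal_correlation * (\<Sum>j=1..K. x j * \<gamma> j) + (1 - signal_correlation) * (x k * \<gamma> k)) * \<mu>"])
  let ?m = "posterior t" and ?q = signal_correlation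
  have A: "aggregate_action K x (affine_action \<alpha> \<gamma> ?m) =
      (\<lambda>\<omega>. (\<Sum>j=1..K. x j * \<alpha> j) + (\<Sum>j=1..K. x j * \<gamma> j * ?m j \<omega>))"
    by (simp add: aggregate_action_def[abs_def] affine_action_def fun_eq_iff distrib_left sum.distrib mult.assoc)
  show "?m k \<in> borel_measurable M" by simp
  show "integrable M (aggregate_action K x (affine_action \<alpha> \<gamma> ?m))"
    unfolding A
    by (intro Bochner_Integration.integrable_add Bochner_Integration.integrable_sum integrable_mult_right
        posterior_moments(1)) simp_all
  show "integrable M (\<lambda>\<omega>. (\<Sum>j=1..K. x j * \<alpha> j) +
      (?q * (\<Sum>j=1..K. x j * \<gamma> j) + (1 - ?q) * (x k * \<gamma> k)) * ?m k \<omega>)"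
    using posterior_moments(1)[OF k] by auto
  fix B :: "real set" assume B[measurable]: "B \<in> sets borel"
  let ?W = "\<lambda>\<omega>. indicator B (?m k \<omega>) :: real"
  let ?E = "expectation (\<lambda>\<omega>. ?W \<omega> * ?m k \<omega>)"
  have W: "integrable M ?W"
    by (rule integrable_const_bound[of _ 1]) (auto split: split_indicator)
  have Wm: "integrable M (\<lambda>\<omega>. ?W \<omega> * ?m j \<omega>)" if "j \<in> {1..K}" for j
    by (rule Bochner_Integration.integrable_bound[OF posterior_moments(1)[OF that, of t]])
       (auto split: split_indicator)
  have "expectation (\<lambda>\<omega>. ?W \<omega> * aggregate_action K x (affine_action \<alpha> \<gamma> ?m) \<omega>) =
      expectation (\<lambda>\<omega>. (\<Sum>j=1..K. x j * \<alpha> j) * ?W \<omega> + (\<Sum>j=1..K. x j * \<gamma> j * (?W \<omega> * ?m j \<omega>)))"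
    unfolding A by (simp add: distrib_left sum_distrib_left mult_ac)
  also have "\<dots> = (\<Sum>j=1..K. x j * \<alpha> j) * expectation ?W + (\<Sum>j=1..K. x j * \<gamma> j * expectation (\<lambda>\<omega>. ?W \<omega> * ?m j \<omega>))"
    using W Wm by (subst Bochner_Integration.integral_add) (auto simp: Bochner_Integration.integral_sum)
  \<comment> \<open>Every provider gets the coefficient \<rho>; the \<open>if\<close> adds the
    missing 1 - \<rho> for \<open>j = k\<close>.\<close>
  also have "(\<Sum>j=1..K. x j * \<gamma> j * expectation (\<lambda>\<omega>. ?W \<omega> * ?m j \<omega>)) =
      (\<Sum>j=1..K. ?q * (x j * \<gamma> j) * ?E + (if j = k then (1 - ?q) * (x k * \<gamma> k) * ?E else 0))"
  proof (rule sum.cong[OF refl])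
    fix j assume j: "j \<in> {1..K}"
    show "x j * \<gamma> j * expectation (\<lambda>\<omega>. ?W \<omega> * ?m j \<omega>) =
        ?q * (x j * \<gamma> j) * ?E + (if j = k then (1 - ?q) * (x k * \<gamma> k) * ?E else 0)"
      using expectation_other_posterior[OF k j B, of t] by (cases "j = k") (simp_all add: algebra_simps)
  qed
  also have "\<dots> = (?q * (\<Sum>j=1..K. x j * \<gamma> j) + (1 - ?q) * (x k * \<gamma> k)) * ?E"
    using k by (simp add: sum.distrib sum_distrib_left sum_distrib_right algebra_simps)
  also have "(\<Sum>j=1..K. x j * \<alpha> j) * expectation ?W + \<dots> =
      expectation (\<lambda>\<omega>. (\<Sum>j=1..K. x j * \<alpha> j) * ?W \<omega> +
        (?q * (\<Sum>j=1..K. x j * \<gamma> j) + (1 - ?q) * (x k * \<gamma> k)) * (?W \<omega> * ?m k \<omega>))"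
    using W Wm[OF k] by simp
  also have "\<dots> = expectation (\<lambda>\<omega>. ?W \<omega> * ((\<Sum>j=1..K. x j * \<alpha> j) +
        (?q * (\<Sum>j=1..K. x j * \<gamma> j) + (1 - ?q) * (x k * \<gamma> k)) * ?m k \<omega>))"
    by (simp add: algebra_simps)
  finally show "expectation (\<lambda>\<omega>. ?W \<omega> * aggregate_action K x (affine_action \<alpha> \<gamma> ?m) \<omega>) =
     expectation (\<lambda>\<omega>. ?W \<omega> * ((\<Sum>j=1..K. x j * \<alpha> j) +
        (?q * (\<Sum>j=1..K. x j * \<gamma> j) + (1 - ?q) * (x k * \<gamma> k)) * ?m k \<omega>))" .
qed simp

text \<open>Integrating gives the intercepts, as m_k is centred; integrating after multiplication by
  m_k gives the slopes, as its variance is positive.\<close>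

lemma affine_posterior_unique:
  assumes k: "k \<in> {1..K}" and eq: "AE \<omega> in M. p + q * posterior t k \<omega> = p' + q' * posterior t k \<omega>"
  shows "p = p'" "q = q'"
proof -
  let ?m = "posterior t k"
  note mom = posterior_moments(1-3)[OF k, of t]
  have "expectation (\<lambda>\<omega>. p + q * ?m \<omega>) = expectation (\<lambda>\<omega>. p' + q' * ?m \<omega>)"
    using eq by (intro integral_cong_AE) auto
  then show "p = p'" using mom by (simp add: prob_space)
  have "expectation (\<lambda>\<omega>. p * ?m \<omega> + q * (?m \<omega>)\<^sup>2) = expectation (\<lambda>\<omega>. p' * ?m \<omega> + q' * (?m \<omega>)\<^sup>2)"
  proof (intro integral_cong_AE)
    show "AE \<omega> in M. p * ?m \<omega> + q * (?m \<omega>)\<^sup>2 = p' * ?m \<omega> + q' * (?m \<omega>)\<^sup>2"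
      using eq
    proof eventually_elim
      case (elim \<omega>)
      then have "(p + q * ?m \<omega>) * ?m \<omega> = (p' + q' * ?m \<omega>) * ?m \<omega>" by simp
      then show ?case by (simp add: algebra_simps power2_eq_square)
    qed
  qed auto
  moreover have "expectation (\<lambda>\<omega>. (?m \<omega>)\<^sup>2) = signal_variance"
    using posterior_moments(5)[OF k k, of t] by (simp add: power2_eq_square)
  ultimately show "q = q'" using mom signal_variance_pos by simp
qed

lemma equilibrium_first_order:
  assumes eq: "affine_delegated_equilibrium M K (posterior t) c \<psi> \<xi> \<beta> d x \<alpha> \<gamma>"
    and "\<beta> > 0" and k: "k \<in> {1..K}"
  shows "2 * \<beta> * \<alpha> k = \<psi> + \<beta> * c + d * (\<Sum>j=1..K. x j * \<alpha> j)"
    and "2 * \<beta> * \<gamma> k = \<xi> + d * (signal_correlation * (\<Sum>j=1..K. x j * \<gamma> j) + (1 - signal_correlation) * (x k * \<gamma> k))"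
proof -
  let ?m = "posterior t k"
  let ?A = "\<Sum>j=1..K. x j * \<alpha> j"
  let ?G = "signal_correlation * (\<Sum>j=1..K. x j * \<gamma> j) + (1 - signal_correlation) * (x k * \<gamma> k)"
  let ?e = "cond_exp_given M ?m (aggregate_action K x (affine_action \<alpha> \<gamma> (posterior t)))"
  have "AE \<omega> in M. \<forall>b. client_payoff c \<psi> \<xi> \<beta> d (?m \<omega>) (?e \<omega>) b \<le>
      client_payoff c \<psi> \<xi> \<beta> d (?m \<omega>) (?e \<omega>) (affine_action \<alpha> \<gamma> (posterior t) k \<omega>)"
    using eq k unfolding affine_delegated_equilibrium_def by blast
  then have "AE \<omega> in M. 2 * \<beta> * \<alpha> k + 2 * \<beta> * \<gamma> k * ?m \<omega> = (\<psi> + \<beta> * c + d * ?A) + (\<xi> + d * ?G) * ?m \<omega>"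
    using cond_exp_aggregate_action[OF k, of t x \<alpha> \<gamma>]
  proof eventually_elim
    case (elim \<omega>)
    have "2 * \<beta> * affine_action \<alpha> \<gamma> (posterior t) k \<omega> = (\<psi> + \<xi> * ?m \<omega> + d * ?e \<omega>) + \<beta> * c"
      using elim(1) by (intro quadratic_optimum \<open>\<beta> > 0\<close>) (simp add: client_payoff_def algebra_simps)
    then show ?case unfolding elim(2) by (simp add: affine_action_def algebra_simps)
  qed
  from affine_posterior_unique[OF k this]
  show "2 * \<beta> * \<alpha> k = \<psi> + \<beta> * c + d * ?A" "2 * \<beta> * \<gamma> k = \<xi> + d * ?G" .
qed

text \<open>Averaging the first-order conditions with the shares shows that the mean intercept
  solves the same equation as every single intercept, also for a provider with share 0.\<close>

lemma equilibrium_intercept: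
  assumes eq: "affine_delegated_equilibrium M K (posterior t) c \<psi> \<xi> \<beta> d x \<alpha> \<gamma>"
    and "0 < d" "d < \<beta>" and x: "share_vector K x" and k: "k \<in> {1..K}"
  shows "\<alpha> k = (\<psi> + \<beta> * c) / (2 * \<beta> - d)"
proof -
  let ?A = "\<Sum>j=1..K. x j * \<alpha> j"
  have "\<beta> > 0" using assms by simp
  note foc = equilibrium_first_order(1)[OF eq \<open>\<beta> > 0\<close>]
  have "2 * \<beta> * ?A = (\<Sum>j=1..K. x j * (\<psi> + \<beta> * c + d * ?A))"
    unfolding sum_distrib_left[of "2 * \<beta>"] using foc by (intro sum.cong) (auto simp: mult_ac)
  also have "\<dots> = \<psi> + \<beta> * c + d * ?A"
    using x by (simp add: share_vector_def flip: sum_distrib_right)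
  finally have "2 * \<beta> * \<alpha> k = 2 * \<beta> * ?A" using foc[OF k] by simp
  then have "\<alpha> k = ?A" using \<open>\<beta> > 0\<close> by simp
  then have "(2 * \<beta> - d) * \<alpha> k = \<psi> + \<beta> * c" using foc[OF k] by (simp add: algebra_simps)
  then show ?thesis using assms by (simp add: field_simps)
qed

text \<open>With these parameters \<delta> + r = d, so \<delta> + r < b amounts to d <
  2\<beta>.\<close>

lemma concentration_locale:
  assumes "0 < d" "d < \<beta>" "0 < \<xi>"
  shows "concentration (2 * \<beta>) (d * (1 - signal_correlation)) (d * signal_correlation) \<xi> signal_correlation"
  using assms signal_correlation_bounds by unfold_locales (auto simp: algebra_simps)

text \<open>The slopes of the other providers enter a first-order condition only through S, so the
  system collapses to the scalar fixed point S = \<Lambda>(\<xi> + rS).\<close>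

lemma equilibrium_slopes:
  fixes d :: real
  assumes eq: "affine_delegated_equilibrium M K (posterior t) c \<psi> \<xi> \<beta> d x \<alpha> \<gamma>"
    and d: "0 < d" "d < \<beta>" and "0 < \<xi>" and x: "share_vector K x"
  defines "\<delta> \<equiv> d * (1 - signal_correlation)" and "r \<equiv> d * signal_correlation"
  defines "L \<equiv> concentration.weight_sum (2 * \<beta>) \<delta> K x" and "P \<equiv> concentration.square_sum (2 * \<beta>) \<delta> K x"
  shows "(\<Sum>k=1..K. x k * \<gamma> k) = L * concentration.gain r \<xi> L"
    and "(\<Sum>k=1..K. (x k)\<^sup>2 * (\<gamma> k)\<^sup>2) = (concentration.gain r \<xi> L)\<^sup>2 * P"
proof -
  interpret concentration "2 * \<beta>" \<delta> r \<xi> signal_correlation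
    unfolding \<delta>_def r_def by (rule concentration_locale) fact+
  let ?S = "\<Sum>k=1..K. x k * \<gamma> k"
  have w: "x k * \<gamma> k = w (x k) * (\<xi> + r * ?S)" if k: "k \<in> {1..K}" for k
  proof -
    have pos: "0 < 2 * \<beta> - \<delta> * x k"
      using denominator_pos share_vector_bounds[OF x k] by auto
    have "(2 * \<beta> - \<delta> * x k) * \<gamma> k = \<xi> + r * ?S"
      using equilibrium_first_order(2)[OF eq _ k] d by (simp add: \<delta>_def r_def algebra_simps)
    then have "\<gamma> k = (\<xi> + r * ?S) / (2 * \<beta> - \<delta> * x k)"
      using pos by (simp add: field_simps)
    then show ?thesis by (simp add: share_weight_def)
  qed
  have rL: "r * L < 1" using weight_sum_bounds(2)[OF x] by (simp add: L_def)
  have "?S = (\<Sum>k=1..K. w (x k) * (\<xi> + r * ?S))" by (rule sum.cong[OF refl w])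
  also have "\<dots> = L * (\<xi> + r * ?S)"
    by (simp add: L_def weight_sum_def flip: sum_distrib_right)
  finally have S: "?S = L * (\<xi> + r * ?S)" .
  then have "(1 - r * L) * (\<xi> + r * ?S) = \<xi>" by algebra
  \<comment> \<open>The common numerator of all slopes; r\<Lambda> < 1 permits the division.\<close>
  then have g: "\<xi> + r * ?S = gain L"
    using rL by (simp add: gain_def field_simps)
  show "?S = L * gain L" using S unfolding g .
  have "(\<Sum>k=1..K. (x k)\<^sup>2 * (\<gamma> k)\<^sup>2) = (\<Sum>k=1..K. (w (x k))\<^sup>2 * (gain L)\<^sup>2)"
    using w unfolding g by (intro sum.cong refl) (simp flip: power_mult_distrib)
  also have "\<dots> = (gain L)\<^sup>2 * P"
    unfolding P_def square_sum_def sum_distrib_left by (simp only: mult.commute)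
  finally show "(\<Sum>k=1..K. (x k)\<^sup>2 * (\<gamma> k)\<^sup>2) = (gain L)\<^sup>2 * P" .
qed

section \<open>Moments of the aggregate action and the loss decomposition\<close>

text \<open>The posterior means have equal variances and equal pairwise covariances: the covariance
  matrix is a multiple of \<rho> times the all-ones matrix plus 1 - \<rho> times the identity. Its
  quadratic form at \<open>v\<close> is the second moment.\<close>

lemma posterior_combination_moments:
  fixes v :: "nat \<Rightarrow> real" and t :: 't
  defines "G \<equiv> \<lambda>\<omega>. \<Sum>k=1..K. v k * posterior t k \<omega>"
  shows "integrable M G" "expectation G = 0"
    "integrable M (\<lambda>\<omega>. G \<omega> * \<theta> t \<omega>)" "expectation (\<lambda>\<omega>. G \<omega> * \<theta> t \<omega>) = signal_variance * (\<Sum>k=1..K. v k)"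
    "integrable M (\<lambda>\<omega>. (G \<omega>)\<^sup>2)"
    "expectation (\<lambda>\<omega>. (G \<omega>)\<^sup>2) = signal_variance *
      (signal_correlation * (\<Sum>k=1..K. v k)\<^sup>2 + (1 - signal_correlation) * (\<Sum>k=1..K. (v k)\<^sup>2))"
proof -
  let ?m = "posterior t" and ?q = signal_correlation
  show "integrable M G" unfolding G_def
    by (intro Bochner_Integration.integrable_sum integrable_mult_right posterior_moments(1)) simp
  show "expectation G = 0"
    unfolding G_def using posterior_moments(1,3) by (simp add: Bochner_Integration.integral_sum)
  have mth: "integrable M (\<lambda>\<omega>. ?m k \<omega> * \<theta> t \<omega>)" if "k \<in> {1..K}" for k
    using posterior_moments(2)[OF that] state_moments(1,3) by (intro integrable_mult_of_squares) auto
  have mm: "integrable M (\<lambda>\<omega>. ?m k \<omega> * ?m j \<omega>)" if "k \<in> {1..K}" "j \<in> {1..K}" for k j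
    using posterior_moments(2)[OF that(1)] posterior_moments(2)[OF that(2)]
    by (intro integrable_mult_of_squares) auto
  have Gth: "G \<omega> * \<theta> t \<omega> = (\<Sum>k=1..K. v k * (?m k \<omega> * \<theta> t \<omega>))" for \<omega>
    by (simp add: G_def sum_distrib_right mult.assoc)
  have GG: "(G \<omega>)\<^sup>2 = (\<Sum>k=1..K. \<Sum>j=1..K. v k * v j * (?m k \<omega> * ?m j \<omega>))" for \<omega>
    unfolding G_def power2_eq_square sum_product by (simp add: mult_ac)
  show "integrable M (\<lambda>\<omega>. G \<omega> * \<theta> t \<omega>)" unfolding Gth using mth by auto
  show "expectation (\<lambda>\<omega>. G \<omega> * \<theta> t \<omega>) = signal_variance * (\<Sum>k=1..K. v k)"
    unfolding Gth using mth posterior_moments(4)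
    by (simp add: Bochner_Integration.integral_sum sum_distrib_left mult.commute)
  show "integrable M (\<lambda>\<omega>. (G \<omega>)\<^sup>2)"
    unfolding GG using mm by (intro Bochner_Integration.integrable_sum Bochner_Integration.integrable_mult_right) auto
  have "expectation (\<lambda>\<omega>. (G \<omega>)\<^sup>2) = (\<Sum>k=1..K. \<Sum>j=1..K. v k * v j * expectation (\<lambda>\<omega>. ?m k \<omega> * ?m j \<omega>))"
  proof -
    have inner: "integrable M (\<lambda>\<omega>. v k * v j * (?m k \<omega> * ?m j \<omega>))" if "k \<in> {1..K}" "j \<in> {1..K}" for k j
      using mm[OF that] by simp
    have "expectation (\<lambda>\<omega>. (G \<omega>)\<^sup>2) = (\<Sum>k=1..K. expectation (\<lambda>\<omega>. \<Sum>j=1..K. v k * v j * (?m k \<omega> * ?m j \<omega>)))"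
      unfolding GG by (intro Bochner_Integration.integral_sum Bochner_Integration.integrable_sum inner)
    also have "\<dots> = (\<Sum>k=1..K. \<Sum>j=1..K. v k * v j * expectation (\<lambda>\<omega>. ?m k \<omega> * ?m j \<omega>))"
      using inner by (intro sum.cong refl) (simp add: Bochner_Integration.integral_sum)
    finally show ?thesis .
  qed
  also have "\<dots> = (\<Sum>k=1..K. \<Sum>j=1..K. signal_variance * (?q * (v k * v j) + (if j = k then (1 - ?q) * (v k)\<^sup>2 else 0)))"
    using posterior_moments(5) by (intro sum.cong refl) (auto simp: algebra_simps power2_eq_square)
  also have "\<dots> = signal_variance * (?q * (\<Sum>k=1..K. v k)\<^sup>2 + (1 - ?q) * (\<Sum>k=1..K. (v k)\<^sup>2))"
    unfolding power2_eq_square[of "sum v _"] sum_product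
    by (simp add: sum.distrib flip: sum_distrib_left)
  finally show "expectation (\<lambda>\<omega>. (G \<omega>)\<^sup>2) = signal_variance *
      (?q * (\<Sum>k=1..K. v k)\<^sup>2 + (1 - ?q) * (\<Sum>k=1..K. (v k)\<^sup>2))" .
qed

end

text \<open>Two distinct providers are fixed so that \<open>V\<close> and \<open>\<rho>\<close> can
  be genuine moments of posterior means. The strict claims carry \<upsilon> > 0 or \<kappa> > 0
  because \<open>I\<close> vanishes identically for \<upsilon> = 0 and \<open>II\<close> for
  \<kappa> = 0.\<close>

theorem proposition3:
  fixes M :: "'a measure"
    and \<theta> :: "'t::linordered_ab_semigroup_add \<Rightarrow> 'a \<Rightarrow> real"
    and \<eta> :: "nat \<Rightarrow> 't \<Rightarrow> 'a \<Rightarrow> real"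
    and K i j :: nat
    and t :: 't
    and \<tau>\<^sub>\<theta> \<tau>\<^sub>g \<tau>\<^sub>y c \<psi> \<xi> \<beta> d \<omega>\<^sub>0 \<omega>\<^sub>1 D\<^sub>0 \<upsilon> \<kappa> V \<rho> \<alpha>\<^sub>t L\<^sub>0 :: real
    and m :: "nat \<Rightarrow> 'a \<Rightarrow> real"
    and \<alpha> \<gamma> :: "(nat \<Rightarrow> real) \<Rightarrow> nat \<Rightarrow> real"
    and A P Loss :: "(nat \<Rightarrow> real) \<Rightarrow> 'a \<Rightarrow> real"
    and Load :: "'a \<Rightarrow> real"
    and S Q I II EL :: "(nat \<Rightarrow> real) \<Rightarrow> real"
  assumes signals: "scarcity_signals M \<theta> \<eta> K \<tau>\<^sub>\<theta> \<tau>\<^sub>g \<tau>\<^sub>y"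
    and providers: "i \<in> {1..K}" "j \<in> {1..K}" "i \<noteq> j"
    and payoff: "\<beta> > 0" "0 < d" "d < \<beta>" "\<xi> > 0"
    and W1: "\<omega>\<^sub>1 > 0"
    and W2: "\<upsilon> \<ge> 0"
    and W3: "\<kappa> \<ge> 0"
    and m: "m = posterior_mean M \<theta> \<eta> t"
    and V: "V = prob_space.variance M (m i)"
    and \<rho>: "\<rho> = covariance M (m i) (m j) / prob_space.variance M (m i)"
    and equilibrium:
    "\<And>x. share_vector K x \<Longrightarrow>
       affine_delegated_equilibrium M K m c \<psi> \<xi> \<beta> d x (\<alpha> x) (\<gamma> x)"
    and \<alpha>\<^sub>t: "\<alpha>\<^sub>t = (\<psi> + \<beta> * c) / (2 * \<beta> - d)"
    and S: "S = (\<lambda>x. \<Sum>k=1..K. x k * \<gamma> x k)"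
    and Q: "Q = (\<lambda>x. \<Sum>k=1..K. (x k)\<^sup>2 * (\<gamma> x k)\<^sup>2)"
    and A: "A = (\<lambda>x. aggregate_action K x (affine_action (\<alpha> x) (\<gamma> x) m))"
    and P: "P = (\<lambda>x \<omega>. \<omega>\<^sub>0 + \<omega>\<^sub>1 * A x \<omega>)"
    and Load: "Load = (\<lambda>\<omega>. D\<^sub>0 + \<upsilon> * \<theta> t \<omega>)"
    and Loss: "Loss = (\<lambda>x \<omega>. P x \<omega> * Load \<omega> + \<kappa> / 2 * (P x \<omega> - prob_space.expectation M (P x))\<^sup>2)"
    and EL: "EL = (\<lambda>x. prob_space.expectation M (Loss x))"
    and L\<^sub>0: "L\<^sub>0 = \<omega>\<^sub>0 * D\<^sub>0 + \<omega>\<^sub>1 * D\<^sub>0 * \<alpha>\<^sub>t"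
    and I: "I = (\<lambda>x. \<omega>\<^sub>1 * \<upsilon> * V * S x)"
    and II: "II = (\<lambda>x. \<kappa> / 2 * \<omega>\<^sub>1\<^sup>2 * V * (\<rho> * (S x)\<^sup>2 + (1 - \<rho>) * Q x))"
  shows
    "(\<forall>x. share_vector K x \<longrightarrow>
        (\<forall>k\<in>{1..K}. \<alpha> x k = \<alpha>\<^sub>t) \<and>
        EL x = L\<^sub>0 + I x + II x \<and>
        I x = covariance M (P x) Load \<and>
        II x = \<kappa> / 2 * prob_space.variance M (P x) \<and>
        prob_space.expectation M (P x) = \<omega>\<^sub>0 + \<omega>\<^sub>1 * \<alpha>\<^sub>t) \<and>
     (\<forall>x x'. share_vector K x \<longrightarrow> share_vector K x' \<longrightarrow> majorizes K x' x \<longrightarrow>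
        I x \<le> I x' \<and> II x \<le> II x' \<and> EL x \<le> EL x') \<and>
     (\<upsilon> > 0 \<longrightarrow> strictly_increasing_inside (1 / K) 1 (\<lambda>x\<^sub>D. I (dominant_share K x\<^sub>D))) \<and>
     (\<kappa> > 0 \<longrightarrow> strictly_increasing_inside (1 / K) 1 (\<lambda>x\<^sub>D. II (dominant_share K x\<^sub>D))) \<and>
     (\<upsilon> > 0 \<or> \<kappa> > 0 \<longrightarrow>
        strictly_increasing_inside (1 / K) 1 (\<lambda>x\<^sub>D. EL (dominant_share K x\<^sub>D)))"
proof -
  interpret scarcity_signals M \<theta> \<eta> K \<tau>\<^sub>\<theta> \<tau>\<^sub>g \<tau>\<^sub>y by (rule signals)
  interpret C: concentration "2 * \<beta>" "d * (1 - signal_correlation)" "d * signal_correlation" \<xi> signal_correlation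
    by (rule concentration_locale) (use payoff in auto)
  have K: "K \<ge> 2" using providers by auto
  note mean = posterior_moments(3)
  have V_eq: "V = signal_variance"
    using posterior_moments(5)[OF providers(1,1), of t] mean[OF providers(1), of t]
    by (simp add: V m power2_eq_square)
  have "covariance M (m i) (m j) = signal_correlation * signal_variance"
    using posterior_moments(5)[OF providers(1,2), of t] mean[OF providers(1), of t] mean[OF providers(2), of t] providers(3)
    by (simp add: covariance_def m)
  then have \<rho>_eq: "\<rho> = signal_correlation"
    using signal_variance_pos by (simp add: \<rho> V_eq flip: V)
  have eqm: "affine_delegated_equilibrium M K (posterior t) c \<psi> \<xi> \<beta> d x (\<alpha> x) (\<gamma> x)"
    if "share_vector K x" for x using equilibrium[OF that] by (simp add: m)
  define L where "L x = C.weight_sum K x" for x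
  define R where "R x = C.square_sum K x" for x
  have S_eq: "S x = L x * C.gain (L x)"
    and Q_eq: "Q x = (C.gain (L x))\<^sup>2 * R x" if x: "share_vector K x" for x
    unfolding S Q L_def R_def using equilibrium_slopes[OF eqm[OF x] payoff(2,3,4) x] by simp_all
  have disp: "\<rho> * (S x)\<^sup>2 + (1 - \<rho>) * Q x = C.dispersion (L x) (R x)" if "share_vector K x" for x
    using S_eq[OF that] Q_eq[OF that] by (simp add: \<rho>_eq C.dispersion_def)
  have intercept: "\<alpha> x k = \<alpha>\<^sub>t" if "share_vector K x" "k \<in> {1..K}" for x k
    using equilibrium_intercept[OF eqm[OF that(1)] payoff(2,3) that] by (simp add: \<alpha>\<^sub>t)
  have decomposition: "EL x = L\<^sub>0 + I x + II x \<and> I x = covariance M (P x) Load \<and>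
      II x = \<kappa> / 2 * variance (P x) \<and> expectation (P x) = \<omega>\<^sub>0 + \<omega>\<^sub>1 * \<alpha>\<^sub>t"
    if x: "share_vector K x" for x
  proof -
    \<comment> \<open>The random part of the aggregate action; the intercepts carry all of its
      mean.\<close>
    define G where "G \<omega> = (\<Sum>k=1..K. x k * \<gamma> x k * posterior t k \<omega>)" for \<omega>
    note G = posterior_combination_moments[where t=t and v="\<lambda>k. x k * \<gamma> x k", folded G_def]
    have "A x \<omega> = (\<Sum>k=1..K. x k * \<alpha>\<^sub>t) + G \<omega>" for \<omega>
      using intercept[OF x]
      by (simp add: A m aggregate_action_def affine_action_def G_def distrib_left sum.distrib mult.assoc)
    then have P_eq: "P x = (\<lambda>\<omega>. \<omega>\<^sub>0 + \<omega>\<^sub>1 * \<alpha>\<^sub>t + \<omega>\<^sub>1 * G \<omega>)"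
      using x by (simp add: P share_vector_def distrib_left add.assoc flip: sum_distrib_right)
    have EP: "expectation (P x) = \<omega>\<^sub>0 + \<omega>\<^sub>1 * \<alpha>\<^sub>t"
      unfolding P_eq using G(1,2) by (simp add: prob_space)
    have ELoad: "expectation Load = D\<^sub>0"
      unfolding Load using state_moments(2,4) by (simp add: prob_space)
    have EG\<theta>: "expectation (\<lambda>\<omega>. G \<omega> * \<theta> t \<omega>) = V * S x"
      using G(4) by (simp add: V_eq S)
    have EG2: "expectation (\<lambda>\<omega>. (G \<omega>)\<^sup>2) = V * (\<rho> * (S x)\<^sup>2 + (1 - \<rho>) * Q x)"
      using G(6) by (simp add: V_eq \<rho>_eq S Q power_mult_distrib)
    have dev: "P x \<omega> - expectation (P x) = \<omega>\<^sub>1 * G \<omega>" for \<omega>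
      unfolding EP by (simp add: P_eq)
    have var: "II x = \<kappa> / 2 * variance (P x)"
      unfolding dev by (simp add: II power_mult_distrib EG2)
    have "covariance M (P x) Load = expectation (\<lambda>\<omega>. \<omega>\<^sub>1 * \<upsilon> * (G \<omega> * \<theta> t \<omega>))"
      unfolding covariance_def dev ELoad by (simp add: Load mult_ac)
    then have cov: "I x = covariance M (P x) Load"
      by (simp add: I EG\<theta>)
    \<comment> \<open>Terms linear in \<open>G\<close> or in the state have mean 0; the cross term
      and the square yield \<open>I\<close> and \<open>II\<close>.\<close>
    have "Loss x = (\<lambda>\<omega>. L\<^sub>0 + (\<omega>\<^sub>0 + \<omega>\<^sub>1 * \<alpha>\<^sub>t) * \<upsilon> * \<theta> t \<omega> + \<omega>\<^sub>1 * D\<^sub>0 * G \<omega> +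
        \<omega>\<^sub>1 * \<upsilon> * (G \<omega> * \<theta> t \<omega>) + \<kappa> / 2 * \<omega>\<^sub>1\<^sup>2 * (G \<omega>)\<^sup>2)"
      unfolding Loss dev by (simp add: P_eq Load L\<^sub>0 fun_eq_iff algebra_simps power2_eq_square)
    then have "EL x = L\<^sub>0 + I x + II x"
      using G(1,2,3,5) state_moments(2,4) by (simp add: EL prob_space EG\<theta> EG2 I II)
    then show ?thesis using EP var cov by simp
  qed
  have V_pos: "V > 0" using signal_variance_pos by (simp add: V_eq)
  define a where "a = \<omega>\<^sub>1 * \<upsilon> * V"
  define e where "e = \<kappa> / 2 * \<omega>\<^sub>1\<^sup>2 * V"
  have ae: "0 \<le> a" "0 \<le> e" and a_pos: "\<upsilon> > 0 \<Longrightarrow> 0 < a" and e_pos: "\<kappa> > 0 \<Longrightarrow> 0 < e"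
    using W1 W2 W3 V_pos by (simp_all add: a_def e_def)
  have I_eq: "I x = a * (L x * C.gain (L x))" and II_eq: "II x = e * C.dispersion (L x) (R x)"
    if "share_vector K x" for x
    using S_eq[OF that] disp[OF that] by (simp_all add: I II a_def e_def)
  have EL_eq: "EL x = L\<^sub>0 + a * (L x * C.gain (L x)) + e * C.dispersion (L x) (R x)"
    if "share_vector K x" for x
    using decomposition[OF that] I_eq[OF that] II_eq[OF that] by simp
  have mono: "I x \<le> I x' \<and> II x \<le> II x' \<and> EL x \<le> EL x'"
    if x: "share_vector K x" and x': "share_vector K x'" and maj: "majorizes K x' x" for x x'
  proof -
    have L: "0 \<le> L x" "L x \<le> L x'" "d * signal_correlation * L x' < 1" and R: "0 \<le> R x" "R x \<le> R x'"
      using C.weight_sum_bounds[OF x] C.weight_sum_bounds[OF x'] C.weight_sum_mono[OF x x' maj]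
        C.square_sum_nonneg C.square_sum_mono[OF x x' maj] by (simp_all add: L_def R_def)
    have "I x \<le> I x'" "II x \<le> II x'"
      unfolding I_eq[OF x] I_eq[OF x'] II_eq[OF x] II_eq[OF x']
      using C.aggregate_gain_mono[OF L] C.dispersion_mono[OF L R] ae by (simp_all add: mult_left_mono)
    then show ?thesis
      using conjunct1[OF decomposition[OF x]] conjunct1[OF decomposition[OF x']] by linarith
  qed
  note increasing = C.dominant_objective_increasing[OF K, folded L_def R_def]
  \<comment> \<open>The weights (a, 0), (0, e) and (a, e) give \<open>I\<close>, \<open>II\<close>
    and \<open>EL\<close>.\<close>
  show ?thesis
    using intercept decomposition mono increasing[of a 0 I 0] increasing[of 0 e II 0] increasing[of a e EL L\<^sub>0]
      ae a_pos e_pos I_eq II_eq EL_eq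
    by auto
qed

end
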